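(* Each loop threshold graph is Hoffman-London. Furthermore, if $H$ is a loop threshold graph, then $H$ is strongly Hoffman-London if and only if, after removing all isolated vertices from $H$, the resulting graph is neither empty nor a fully looped complete graph.
   Context: Let $K_1$ be the graph on one vertex with no edges and $K_1^{\circ}$ the graph on one vertex with a loop. The family of loop threshold graphs is the minimal (by inclusion) family of graphs that includes $K_1$ and $K_1^{\circ}$, is closed under adding isolated (unlooped) vertices, and is closed under adding looped dominating vertices (a new vertex with a loop that is adjacent to all other vertices). In the statement about removing isolated vertices, a vertex $v$ is considered isolated if $N(v)\subseteq\{v\}$, so a single vertex with a loop and no other neighbor is also isolated. An empty graph is one with no edges (possibly with no vertices). A fully looped complete graph is a graph in which every two distinct vertices are adjacent and every vertex has a loop. For a target graph $H$ (finite, no multiple edges, possibly with loops) and a simple loopless graph $G$, an $H$-coloring of $G$ is a map $f:V(G)\to V(H)$ such that $f(u)\sim_H f(v)$ whenever $u\sim_G v$; $\hom(G,H)$ denotes the number of $H$-colorings of $G$. $\mathcal{T}_n$ is the set of all trees on $n$ vertices (up to isomorphism) and $P_n\in\mathcal{T}_n$ is the path on $n$ vertices. $H$ is Hoffman-London if for all $n\ge 1$, $\hom(P_n,H)=\min_{T_n\in\mathcal{T}_n}\hom(T_n,H)$; $H$ is strongly Hoffman-London if $\hom(P_n,H)<\hom(T_n,H)$ for all $n\ge 1$ and all $T_n\in\mathcal{T}_n\setminus\{P_n\}$. *)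

theory Defs
  imports "HOL-Library.FuncSet" "Graph_Theory.Graph_Theory"
begin

text \<open>
  Undirected graphs without multiple edges are represented by symmetric sets of arcs, as in
  \<^theory>\<open>Graph_Theory.Pair_Digraph\<close>: an edge between distinct vertices u and v is the pair of arcs
  (u,v) and (v,u), and a loop at v is the arc (v,v). Simple loopless finite graphs are described by
  \<^const>\<open>pair_graph\<close>, finite graphs possibly with loops by \<^const>\<open>pair_pseudo_graph\<close>.
\<close>

text \<open>
  The library's \<^const>\<open>tree\<close> forbids every directed cycle. In a symmetric digraph each edge gives
  the directed closed walk u, v, u, so only directed cycles with at least three arcs
  are undirected cycles.
\<close>
definition undirected_tree :: "'a pair_pre_digraph \<Rightarrow> bool" where
  "undirected_tree T \<longleftrightarrow> pair_graph T \<and> connected (with_proj T) \<and>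
     \<not> (\<exists>p. pre_digraph.cycle (with_proj T) p \<and> length p \<ge> 3)"

text \<open>
  Trees on n vertices, represented by the labelled trees on {0, ..., n-1}: every isomorphism class
  occurs, and the number of H-colourings only depends on the isomorphism class.
\<close>
definition trees :: "nat \<Rightarrow> nat pair_pre_digraph set" where
  "trees n = {T. undirected_tree T \<and> pverts T = {..<n}}"

definition path_graph :: "nat \<Rightarrow> nat pair_pre_digraph" where
  "path_graph n = \<lparr> pverts = {..<n},
     parcs = {(u, v). u < n \<and> v < n \<and> (v = Suc u \<or> u = Suc v)} \<rparr>"

text \<open>Colourings are taken to be extensional functions, so that they can be counted.\<close>
definition colorings :: "'a pair_pre_digraph \<Rightarrow> 'b pair_pre_digraph \<Rightarrow> ('a \<Rightarrow> 'b) set" where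
  "colorings G H = {f \<in> pverts G \<rightarrow>\<^sub>E pverts H. \<forall>(u, v) \<in> parcs G. (f u, f v) \<in> parcs H}"

definition hom_count :: "'a pair_pre_digraph \<Rightarrow> 'b pair_pre_digraph \<Rightarrow> nat" where
  "hom_count G H = card (colorings G H)"

definition hoffman_london :: "'b pair_pre_digraph \<Rightarrow> bool" where
  "hoffman_london H \<longleftrightarrow>
     (\<forall>n\<ge>1. hom_count (path_graph n) H = Min ((\<lambda>T. hom_count T H) ` trees n))"

definition strongly_hoffman_london :: "'b pair_pre_digraph \<Rightarrow> bool" where
  "strongly_hoffman_london H \<longleftrightarrow>
     (\<forall>n\<ge>1. \<forall>T \<in> trees n. \<not> digraph_iso (with_proj T) (with_proj (path_graph n)) \<longrightarrow>
        hom_count (path_graph n) H < hom_count T H)"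

inductive loop_threshold :: "'b pair_pre_digraph \<Rightarrow> bool" where
  unlooped_vertex: "loop_threshold \<lparr> pverts = {v}, parcs = {} \<rparr>"
| looped_vertex: "loop_threshold \<lparr> pverts = {v}, parcs = {(v, v)} \<rparr>"
| add_isolated: "loop_threshold H \<Longrightarrow> v \<notin> pverts H \<Longrightarrow>
    loop_threshold \<lparr> pverts = insert v (pverts H), parcs = parcs H \<rparr>"
| add_looped_dominating: "loop_threshold H \<Longrightarrow> v \<notin> pverts H \<Longrightarrow>
    loop_threshold \<lparr> pverts = insert v (pverts H),
      parcs = parcs H \<union> {v} \<times> insert v (pverts H) \<union> insert v (pverts H) \<times> {v} \<rparr>"

definition neighborhood :: "'b pair_pre_digraph \<Rightarrow> 'b \<Rightarrow> 'b set" where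
  "neighborhood H v = {w. (v, w) \<in> parcs H}"

text \<open>A vertex whose only neighbour is itself counts as isolated.\<close>
definition isolated_verts :: "'b pair_pre_digraph \<Rightarrow> 'b set" where
  "isolated_verts H = {v \<in> pverts H. neighborhood H v \<subseteq> {v}}"

definition remove_isolated :: "'b pair_pre_digraph \<Rightarrow> ('b, 'b \<times> 'b) pre_digraph" where
  "remove_isolated H = with_proj H \<restriction> (pverts H - isolated_verts H)"

definition empty_graph :: "('a, 'b) pre_digraph \<Rightarrow> bool" where
  "empty_graph G \<longleftrightarrow> arcs G = {}"

definition fully_looped_complete :: "('a, 'b) pre_digraph \<Rightarrow> bool" where
  "fully_looped_complete G \<longleftrightarrow>
     (\<forall>u \<in> verts G. \<forall>v \<in> verts G. u \<noteq> v \<longrightarrow> u \<rightarrow>\<^bsub>G\<^esub> v) \<and> (\<forall>v \<in> verts G. v \<rightarrow>\<^bsub>G\<^esub> v)"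

lemma loop_threshold_pair_pseudo_graph:
  "loop_threshold H \<Longrightarrow> pair_pseudo_graph H"
proof (induction rule: loop_threshold.induct)
  case (add_isolated H v)
  then interpret pair_pseudo_graph H by simp
  show ?case
    using pair_finite_verts pair_finite_arcs pair_sym_arcs wellformed'
    by unfold_locales (auto simp: symmetric_def sym_def)
next
  case (add_looped_dominating H v)
  then interpret pair_pseudo_graph H by simp
  show ?case
    using pair_finite_verts pair_finite_arcs pair_sym_arcs wellformed'
    by unfold_locales (auto simp: symmetric_def sym_def)
qed (unfold_locales, auto simp: symmetric_def sym_def)+

lemma finite_trees: "finite (trees n)"
proof (rule finite_subset)
  show "trees n \<subseteq> (\<lambda>(V, E). \<lparr> pverts = V, parcs = E \<rparr>) ` ({{..<n}} \<times> Pow ({..<n} \<times> {..<n}))"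
  proof
    fix T assume T: "T \<in> trees n"
    then interpret pair_graph T by (simp add: trees_def undirected_tree_def)
    have "pverts T = {..<n}" using T by (simp add: trees_def)
    moreover have "parcs T \<subseteq> {..<n} \<times> {..<n}"
      using wellformed' calculation by auto
    ultimately have "(pverts T, parcs T) \<in> {{..<n}} \<times> Pow ({..<n} \<times> {..<n})" by simp
    moreover have "T = (\<lambda>(V, E). \<lparr> pverts = V, parcs = E \<rparr>) (pverts T, parcs T)" by simp
    ultimately show "T \<in> (\<lambda>(V, E). \<lparr> pverts = V, parcs = E \<rparr>) ` ({{..<n}} \<times> Pow ({..<n} \<times> {..<n}))"
      by (rule rev_image_eqI)
  qed
qed simp

end

theory Submission
  imports Defs
begin

text \<open>
  A loop threshold graph H has neighbourhoods linearly ordered by inclusion. If x i is the number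
  of colourings of a rooted tree whose root gets colour i, then x is monotone with respect to this
  order. Let A be the adjacency operator of H and \<open>p\<^sub>k = A\<^sup>k 1\<close>, which is the vector of a path
  with k edges rooted at an end. For monotone x and y, symmetrising the double sum over
  the entries of the symmetric matrix \<open>A\<^sup>a\<close> gives
  \<open>\<Sum>\<^sub>i x\<^sub>i y\<^sub>i p\<^sub>a(i) - \<Sum>\<^sub>i x\<^sub>i (A\<^sup>a y)\<^sub>i = 1/2 \<Sum>\<^sub>i\<^sub>k A\<^sup>a\<^sub>i\<^sub>k (x\<^sub>i - x\<^sub>k) (y\<^sub>i - y\<^sub>k) \<ge> 0\<close>.
  With \<open>y = p\<^sub>b\<close> this says that merging two paths of lengths a and b hanging off a common
  vertex into one path of length a + b does not increase the number of colourings. Straightening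
  all branches of a tree in this way leads to the path. If the tree has a vertex of degree at
  least 3 and H has non-adjacent vertices \<open>y\<close>, \<open>y'\<close> of positive degree, then the summand belonging
  to \<open>y\<close> and a dominating vertex makes one merging step strict. If all adjacent vertices of H have
  equal neighbourhoods, then the star with three edges has as many colourings as the path.
\<close>

section \<open>Graphs with nested neighbourhoods\<close>

locale nested_graph =
  fixes V :: "'b set" and A :: "('b \<times> 'b) set"
  assumes finite_V: "finite V"
    and A_subset: "A \<subseteq> V \<times> V"
    and sym_A: "sym A"
    and nested: "\<lbrakk>i \<in> V; j \<in> V\<rbrakk> \<Longrightarrow> A `` {i} \<subseteq> A `` {j} \<or> A `` {j} \<subseteq> A `` {i}"
begin

section \<open>The adjacency operator, its powers and monotone vectors\<close>

definition adj :: "('b \<Rightarrow> real) \<Rightarrow> 'b \<Rightarrow> real" where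
  "adj x i = (\<Sum>j\<in>A `` {i}. x j)"

definition walks :: "nat \<Rightarrow> 'b \<Rightarrow> real" where
  "walks k = (adj ^^ k) (\<lambda>_. 1)"

text \<open>Nonnegativity is included so that products of such vectors are again monotone.\<close>

definition nbhd_mono :: "('b \<Rightarrow> real) \<Rightarrow> bool" where
  "nbhd_mono x \<longleftrightarrow> (\<forall>i\<in>V. 0 \<le> x i) \<and>
     (\<forall>i\<in>V. \<forall>j\<in>V. A `` {i} \<subseteq> A `` {j} \<longrightarrow> x i \<le> x j)"

lemma nbhd_subset: "A `` {i} \<subseteq> V"
  using A_subset by auto

lemma finite_nbhd: "finite (A `` {i})"
  using nbhd_subset finite_V finite_subset by blast

lemma adj_conv: "adj x i = (\<Sum>j\<in>V. of_bool ((i, j) \<in> A) * x j)"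
proof -
  have "adj x i = (\<Sum>j\<in>A `` {i}. of_bool ((i, j) \<in> A) * x j)"
    unfolding adj_def by (rule sum.cong) auto
  also have "\<dots> = (\<Sum>j\<in>V. of_bool ((i, j) \<in> A) * x j)"
    by (rule sum.mono_neutral_left) (use finite_V nbhd_subset in auto)
  finally show ?thesis .
qed

lemma adj_cong: "(\<And>j. j \<in> V \<Longrightarrow> x j = y j) \<Longrightarrow> adj x = adj y"
  by (auto simp: adj_conv fun_eq_iff)

lemma adj_nonneg:
  assumes "\<And>j. j \<in> V \<Longrightarrow> 0 \<le> x j"
  shows "0 \<le> adj x i"
  unfolding adj_def using assms nbhd_subset by (intro sum_nonneg) auto

lemma adj_self_adjoint: "(\<Sum>i\<in>V. x i * adj y i) = (\<Sum>i\<in>V. adj x i * y i)"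
proof -
  have "(\<Sum>i\<in>V. x i * adj y i) = (\<Sum>i\<in>V. \<Sum>j\<in>V. x i * (of_bool ((i, j) \<in> A) * y j))"
    by (simp add: adj_conv sum_distrib_left)
  also have "\<dots> = (\<Sum>j\<in>V. \<Sum>i\<in>V. x i * (of_bool ((i, j) \<in> A) * y j))"
    by (rule sum.swap)
  also have "\<dots> = (\<Sum>j\<in>V. \<Sum>i\<in>V. of_bool ((j, i) \<in> A) * x i * y j)"
    using sym_A by (intro sum.cong refl) (auto simp: sym_def)
  also have "\<dots> = (\<Sum>j\<in>V. adj x j * y j)"
    by (simp add: adj_conv sum_distrib_right)
  finally show ?thesis .
qed

lemma adj_pow_self_adjoint:
  "(\<Sum>i\<in>V. x i * (adj ^^ k) y i) = (\<Sum>i\<in>V. (adj ^^ k) x i * y i)"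
proof (induction k arbitrary: y)
  case (Suc k)
  have "(\<Sum>i\<in>V. x i * (adj ^^ Suc k) y i) = (\<Sum>i\<in>V. x i * (adj ^^ k) (adj y) i)"
    by (simp only: funpow_Suc_right o_apply)
  also have "\<dots> = (\<Sum>i\<in>V. (adj ^^ k) x i * adj y i)"
    by (rule Suc)
  also have "\<dots> = (\<Sum>i\<in>V. (adj ^^ Suc k) x i * y i)"
    by (simp add: adj_self_adjoint)
  finally show ?case .
qed simp

text \<open>An entry of the k-th power of the adjacency matrix, obtained from the image of a unit
  vector.\<close>

definition walks_between :: "nat \<Rightarrow> 'b \<Rightarrow> 'b \<Rightarrow> real" where
  "walks_between k i = (adj ^^ k) (\<lambda>j. of_bool (j = i))"

text \<open>Evaluation at \<open>i\<close> is the pairing with the unit vector at \<open>i\<close>;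
  self-adjointness moves the power onto that unit vector.\<close>

lemma adj_pow_conv:
  assumes "i \<in> V"
  shows "(adj ^^ k) x i = (\<Sum>j\<in>V. walks_between k i j * x j)"
proof -
  have "(adj ^^ k) x i = (\<Sum>j\<in>V. of_bool (j = i) * (adj ^^ k) x j)"
    using assms finite_V by (simp add: of_bool_def sum.delta if_distrib[of "\<lambda>c. c * _"] cong: if_cong)
  then show ?thesis
    by (simp add: adj_pow_self_adjoint walks_between_def)
qed

lemma walks_between_commute:
  assumes "i \<in> V" "j \<in> V"
  shows "walks_between k i j = walks_between k j i"
proof -
  have "walks_between k j i = (adj ^^ k) (\<lambda>l. of_bool (l = j)) i"
    by (simp add: walks_between_def)
  also have "\<dots> = (\<Sum>l\<in>V. walks_between k i l * of_bool (l = j))"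
    by (rule adj_pow_conv[OF assms(1)])
  also have "\<dots> = walks_between k i j"
    using assms finite_V by (simp add: of_bool_def sum.delta if_distrib[of "\<lambda>c. _ * c"] cong: if_cong)
  finally show ?thesis by simp
qed

lemma adj_pow_nonneg:
  assumes "\<And>j. j \<in> V \<Longrightarrow> 0 \<le> x j" "i \<in> V"
  shows "0 \<le> (adj ^^ k) x i"
  using assms(2) by (induction k arbitrary: i) (auto intro: assms(1) adj_nonneg)

lemma walks_between_nonneg: "i \<in> V \<Longrightarrow> j \<in> V \<Longrightarrow> 0 \<le> walks_between k i j"
  unfolding walks_between_def by (rule adj_pow_nonneg) auto

lemma nbhd_mono_1: "nbhd_mono (\<lambda>_. 1)"
  by (simp add: nbhd_mono_def)

lemma nbhd_mono_mult: "nbhd_mono x \<Longrightarrow> nbhd_mono y \<Longrightarrow> nbhd_mono (\<lambda>i. x i * y i)"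
  by (auto simp: nbhd_mono_def intro: mult_mono)

lemma nbhd_mono_adj: "nbhd_mono x \<Longrightarrow> nbhd_mono (adj x)"
  unfolding nbhd_mono_def using nbhd_subset
  by (auto intro: adj_nonneg) (auto simp: adj_def intro!: sum_mono2 finite_nbhd)

lemma nbhd_mono_walks: "nbhd_mono (walks k)"
  unfolding walks_def by (induction k) (simp_all add: nbhd_mono_1 nbhd_mono_adj)

lemma walks_add: "walks (a + b) = (adj ^^ a) (walks b)"
  by (simp add: walks_def funpow_add)

lemma walks_0: "walks 0 = (\<lambda>_. 1)"
  by (simp add: walks_def)

lemma walks_Suc: "walks (Suc k) = adj (walks k)"
  by (simp add: walks_def)

lemma walks_conv: "i \<in> V \<Longrightarrow> walks a i = (\<Sum>k\<in>V. walks_between a i k)"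
  unfolding walks_def using adj_pow_conv[of i a "\<lambda>_. 1"] by simp

section \<open>A Chebyshev sum inequality weighted by walk counts\<close>

lemma chebyshev_identity:
  "2 * ((\<Sum>i\<in>V. x i * y i * walks a i) - (\<Sum>i\<in>V. x i * (adj ^^ a) y i)) =
    (\<Sum>i\<in>V. \<Sum>k\<in>V. walks_between a i k * ((x i - x k) * (y i - y k)))" (is "2 * (?L - ?R) = ?S")
proof -
  let ?W = "walks_between a"
  have L: "?L = (\<Sum>i\<in>V. \<Sum>k\<in>V. ?W i k * (x i * y i))"
    by (intro sum.cong) (simp_all add: walks_conv sum_distrib_left mult_ac)
  have R: "?R = (\<Sum>i\<in>V. \<Sum>k\<in>V. ?W i k * (x i * y k))"
    by (intro sum.cong) (simp_all add: adj_pow_conv sum_distrib_left mult_ac)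
  \<comment> \<open>Since \<open>?W\<close> is symmetric, exchanging the two indices gives second
    copies of both sums; together the four double sums complete the product of differences.\<close>
  have L': "?L = (\<Sum>i\<in>V. \<Sum>k\<in>V. ?W i k * (x k * y k))"
    unfolding L by (subst sum.swap) (intro sum.cong refl, simp add: walks_between_commute)
  have R': "?R = (\<Sum>i\<in>V. \<Sum>k\<in>V. ?W i k * (x k * y i))"
    unfolding R by (subst sum.swap) (intro sum.cong refl, simp add: walks_between_commute)
  have "2 * (?L - ?R) = ?L + ?L - ?R - ?R" by simp
  also have "\<dots> = (\<Sum>i\<in>V. \<Sum>k\<in>V. ?W i k * (x i * y i)) + (\<Sum>i\<in>V. \<Sum>k\<in>V. ?W i k * (x k * y k))
     - (\<Sum>i\<in>V. \<Sum>k\<in>V. ?W i k * (x i * y k)) - (\<Sum>i\<in>V. \<Sum>k\<in>V. ?W i k * (x k * y i))"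
    using L L' R R' by argo
  also have "\<dots> = ?S"
    by (simp add: sum.distrib[symmetric] sum_subtractf[symmetric] algebra_simps)
  finally show ?thesis .
qed

text \<open>Nestedness makes any two vertices comparable, so the two differences never have opposite
  signs.\<close>

lemma nbhd_mono_same_order:
  assumes "nbhd_mono x" "nbhd_mono y" "i \<in> V" "k \<in> V"
  shows "0 \<le> (x i - x k) * (y i - y k)"
proof (cases "A `` {i} \<subseteq> A `` {k}")
  case True
  then have "x i \<le> x k" "y i \<le> y k" using assms by (auto simp: nbhd_mono_def)
  then show ?thesis by (simp add: mult_nonpos_nonpos)
next
  case False
  then have "A `` {k} \<subseteq> A `` {i}" using nested assms by blast
  then have "x k \<le> x i" "y k \<le> y i" using assms by (auto simp: nbhd_mono_def)
  then show ?thesis by simp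
qed

lemma chebyshev:
  assumes "nbhd_mono x" "nbhd_mono y"
  shows "(\<Sum>i\<in>V. x i * (adj ^^ a) y i) \<le> (\<Sum>i\<in>V. x i * y i * walks a i)"
proof -
  have "0 \<le> (\<Sum>i\<in>V. \<Sum>k\<in>V. walks_between a i k * ((x i - x k) * (y i - y k)))"
    using assms by (intro sum_nonneg mult_nonneg_nonneg nbhd_mono_same_order walks_between_nonneg)
  then show ?thesis
    using chebyshev_identity[of x y a] by simp
qed

text \<open>All summands of the double sum in \<open>chebyshev_identity\<close> are nonnegative, and
  the one for the pair \<open>u\<close>, \<open>v\<close> is positive.\<close>

lemma chebyshev_strict:
  assumes "nbhd_mono x" "nbhd_mono y"
    and "u \<in> V" "v \<in> V" "0 < walks_between a u v" "x u < x v" "y u < y v"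
  shows "(\<Sum>i\<in>V. x i * (adj ^^ a) y i) < (\<Sum>i\<in>V. x i * y i * walks a i)"
proof -
  let ?f = "\<lambda>i k. walks_between a i k * ((x i - x k) * (y i - y k))"
  have nn: "0 \<le> ?f i k" if "i \<in> V" "k \<in> V" for i k
    using assms that by (intro mult_nonneg_nonneg nbhd_mono_same_order walks_between_nonneg)
  have "0 < ?f u v"
    using assms by (simp add: mult_neg_neg)
  then have "0 < (\<Sum>k\<in>V. ?f u k)"
    using assms(3,4) by (intro sum_pos2[OF finite_V, where i = v] nn)
  then have "0 < (\<Sum>i\<in>V. \<Sum>k\<in>V. ?f i k)"
    using assms(3) nn by (auto intro!: sum_pos2[OF finite_V, where i = u] intro: sum_nonneg)
  then show ?thesis
    using chebyshev_identity[of x y a] by simp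
qed

section \<open>Spiders and the merging of their legs\<close>

text \<open>The colouring vector, indexed by the colour of the centre, of paths with
  \<open>ms\<close> edges glued together at a common end.\<close>

definition spider :: "nat list \<Rightarrow> 'b \<Rightarrow> real" where
  "spider ms i = (\<Prod>m\<leftarrow>ms. walks m i)"

lemma spider_Nil: "spider [] = (\<lambda>_. 1)"
  and spider_Cons: "spider (m # ms) = (\<lambda>i. walks m i * spider ms i)"
  by (auto simp: spider_def)

lemma walks_add_le_mult:
  assumes "nbhd_mono x"
  shows "(\<Sum>i\<in>V. x i * walks (a + b) i) \<le> (\<Sum>i\<in>V. x i * (walks a i * walks b i))"
  using chebyshev[OF assms nbhd_mono_walks, of a b] by (simp add: walks_add mult_ac)

text \<open>Legs are split off one at a time. Those already split off go into the weight, so the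
  induction has to allow an arbitrary monotone \<open>x\<close>.\<close>

lemma walks_le_spider:
  assumes "nbhd_mono x"
  shows "(\<Sum>i\<in>V. x i * walks (sum_list ms) i) \<le> (\<Sum>i\<in>V. x i * spider ms i)"
  using assms
proof (induction ms arbitrary: x)
  case Nil
  then show ?case by (simp add: spider_Nil walks_0)
next
  case (Cons m ms)
  have "(\<Sum>i\<in>V. x i * walks (sum_list (m # ms)) i) \<le> (\<Sum>i\<in>V. x i * walks m i * walks (sum_list ms) i)"
    using walks_add_le_mult[OF Cons.prems, of m "sum_list ms"] by (simp add: mult_ac)
  also have "\<dots> \<le> (\<Sum>i\<in>V. x i * walks m i * spider ms i)"
    by (rule Cons.IH) (intro nbhd_mono_mult Cons.prems nbhd_mono_walks)
  finally show ?case by (simp add: spider_Cons mult_ac)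
qed

text \<open>If \<open>y'\<close> is not adjacent to \<open>y\<close>, then walks starting at \<open>d\<close> outnumber those starting at \<open>y\<close>,
  because only the former can step to \<open>y'\<close>.\<close>
lemma walks_less:
  assumes y: "(y, d) \<in> A" and y': "(y', d) \<in> A" and d: "\<And>i j. (i, j) \<in> A \<Longrightarrow> (i, d) \<in> A"
    and ny: "(y, y') \<notin> A" and b: "0 < b"
  shows "walks b y < walks b d"
proof -
  have ds: "(d, j) \<in> A" if "(i, j) \<in> A" for i j
    using d[of j i] that sym_A by (auto simp: sym_def)
  have dd: "(d, d) \<in> A" using y ds by blast
  \<comment> \<open>A walk can step to \<open>d\<close> and then use the loop there as often as
    required.\<close>
  have pos: "0 < walks k i" if "(i, d) \<in> A" for k i
    using that
  proof (induction k arbitrary: i)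
    case (Suc k)
    have "0 < (\<Sum>j\<in>A `` {i}. walks k j)"
    proof (rule sum_pos2[of _ d])
      show "0 < walks k d" using Suc.IH dd by blast
      show "0 \<le> walks k j" if "j \<in> A `` {i}" for j
        using that nbhd_subset nbhd_mono_walks[of k] by (auto simp: nbhd_mono_def)
    qed (use Suc.prems finite_nbhd in auto)
    then show ?case by (simp add: walks_Suc adj_def)
  qed (simp add: walks_0)
  obtain k where k: "b = Suc k" using b by (cases b) auto
  have "walks b y = (\<Sum>j\<in>A `` {y}. walks k j)"
    by (simp add: k walks_Suc adj_def)
  also have "\<dots> < (\<Sum>j\<in>A `` {d}. walks k j)"
  proof (rule sum_strict_mono2[where b = y'])
    show "y' \<in> A `` {d} - A `` {y}"
      using y' ny sym_A by (auto simp: sym_def)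
    show "0 < walks k y'" by (rule pos[OF y'])
    show "0 \<le> walks k j" if "j \<in> A `` {d}" for j
      using that nbhd_subset nbhd_mono_walks[of k] by (auto simp: nbhd_mono_def)
  qed (use ds finite_nbhd in auto)
  also have "\<dots> = walks b d"
    by (simp add: k walks_Suc adj_def)
  finally show ?thesis .
qed

text \<open>One step uses the edge between \<open>y\<close> and \<open>d\<close>, all others the
  loop at \<open>d\<close>.\<close>

lemma walks_between_pos:
  assumes "(d, d) \<in> A" "(y, d) \<in> A" "0 < a"
  shows "0 < walks_between a d y"
proof -
  have dV: "d \<in> V" using assms A_subset by auto
  have step: "0 < walks_between (Suc k) d i" if "(i, d) \<in> A" "0 < walks_between k d d" for k i
  proof -
    have "0 < (\<Sum>j\<in>A `` {i}. walks_between k d j)"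
      using that nbhd_subset dV finite_nbhd
      by (intro sum_pos2[of _ d] walks_between_nonneg) auto
    then show ?thesis by (simp add: walks_between_def adj_def)
  qed
  have "0 < walks_between k d d" for k
    by (induction k) (simp add: walks_between_def, rule step[OF assms(1)])
  with step assms show ?thesis by (cases a) auto
qed

text \<open>From one long path, the legs other than \<open>a\<close> and \<open>b\<close> are first
  split off together as one path of length \<open>s\<close>. Separating \<open>a\<close> from
  \<open>b\<close> in its presence is strict; afterwards the path of length \<open>s\<close> is
  split into its own legs by the weak inequality.\<close>

lemma walks_less_spider:
  assumes ms: "3 \<le> length ms" "0 \<notin> set ms"
    and y: "(y, d) \<in> A" and y': "(y', d) \<in> A" and d: "\<And>i j. (i, j) \<in> A \<Longrightarrow> (i, d) \<in> A"
    and ny: "(y, y') \<notin> A"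
  shows "(\<Sum>i\<in>V. walks (sum_list ms) i) < (\<Sum>i\<in>V. spider ms i)"
proof -
  obtain a b c ms' where ms_eq: "ms = a # b # c # ms'"
    using ms(1) by (auto simp: numeral_3_eq_3 Suc_le_length_iff)
  then have pos: "0 < a" "0 < b" "0 < c" using ms(2) by auto
  \<comment> \<open>Including the third leg \<open>c\<close> makes \<open>s\<close> positive, so
    that \<open>walks s\<close> takes different values at \<open>y\<close> and
    \<open>d\<close>.\<close>
  define s where "s = sum_list ms' + c"
  have dd: "(d, d) \<in> A" using y d sym_A by (meson symD)
  have yd: "y \<in> V" "d \<in> V" using y A_subset by auto
  have "(\<Sum>i\<in>V. walks (sum_list ms) i) = (\<Sum>i\<in>V. 1 * walks (s + (a + b)) i)"
    by (simp add: ms_eq s_def add_ac)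
  also have "\<dots> \<le> (\<Sum>i\<in>V. 1 * (walks s i * walks (a + b) i))"
    by (rule walks_add_le_mult[OF nbhd_mono_1])
  also have "\<dots> = (\<Sum>i\<in>V. walks s i * (adj ^^ a) (walks b) i)"
    by (simp add: walks_add)
  also have "\<dots> < (\<Sum>i\<in>V. walks s i * walks b i * walks a i)"
  proof (rule chebyshev_strict[OF nbhd_mono_walks nbhd_mono_walks])
    show "0 < walks_between a y d"
      using walks_between_pos[OF dd y pos(1)] walks_between_commute yd by simp
    show "walks s y < walks s d" "walks b y < walks b d"
      using walks_less[OF y y' d ny] pos by (auto simp: s_def)
  qed (use yd in auto)
  also have "\<dots> = (\<Sum>i\<in>V. walks a i * walks b i * walks (sum_list (c # ms')) i)"
    by (simp add: s_def mult_ac add_ac)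
  also have "\<dots> \<le> (\<Sum>i\<in>V. walks a i * walks b i * spider (c # ms') i)"
    by (intro walks_le_spider nbhd_mono_mult nbhd_mono_walks)
  also have "\<dots> = (\<Sum>i\<in>V. spider ms i)"
    by (simp add: ms_eq spider_Cons mult_ac)
  finally show ?thesis .
qed

end

section \<open>Rooted trees\<close>

text \<open>Each step hangs a whole tree below the root by a single edge, because colouring counts
  factor along this operation.\<close>

inductive rooted_tree :: "'a set \<Rightarrow> ('a \<times> 'a) set \<Rightarrow> 'a \<Rightarrow> bool" where
  single: "rooted_tree {r} {} r"
| join: "rooted_tree V1 E1 r \<Longrightarrow> rooted_tree V2 E2 s \<Longrightarrow> V1 \<inter> V2 = {} \<Longrightarrow>
    rooted_tree (V1 \<union> V2) (E1 \<union> E2 \<union> {(r, s), (s, r)}) r"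

lemma rooted_tree_basic:
  assumes "rooted_tree V E r"
  shows "finite V" "r \<in> V" "E \<subseteq> V \<times> V" "sym E" "(v, v) \<notin> E"
  using assms by (induction) (auto simp: sym_def)

lemma rooted_tree_add_leaf:
  assumes "rooted_tree V E r" "u \<in> V" "w \<notin> V"
  shows "rooted_tree (insert w V) (insert (u, w) (insert (w, u) E)) r"
  using assms
proof (induction)
  case (single r)
  then show ?case
    using join[OF rooted_tree.single[of r] rooted_tree.single[of w]] by (auto simp: insert_commute)
next
  case (join V1 E1 r V2 E2 s)
  show ?case
  proof (cases "u \<in> V1")
    case True
    have "rooted_tree (insert w V1 \<union> V2) (insert (u, w) (insert (w, u) E1) \<union> E2 \<union> {(r, s), (s, r)}) r"
      by (rule rooted_tree.join) (use join True in auto)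
    then show ?thesis by (simp add: insert_commute)
  next
    case False
    have "rooted_tree (V1 \<union> insert w V2) (E1 \<union> insert (u, w) (insert (w, u) E2) \<union> {(r, s), (s, r)}) r"
      by (rule rooted_tree.join) (use join False in auto)
    then show ?thesis by (simp add: insert_commute)
  qed
qed

lemma rooted_tree_reachable:
  assumes "rooted_tree V E r" "v \<in> V"
  shows "(r, v) \<in> E\<^sup>*"
  using assms
proof (induction arbitrary: v)
  case (join V1 E1 r V2 E2 s)
  let ?E = "E1 \<union> E2 \<union> {(r, s), (s, r)}"
  show ?case
  proof (cases "v \<in> V1")
    case True
    then show ?thesis using join.IH(1) rtrancl_mono[of E1 ?E] by auto
  next
    case False
    then have "(s, v) \<in> ?E\<^sup>*" using join rtrancl_mono[of E2 ?E] by auto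
    then show ?thesis by (meson UnCI converse_rtrancl_into_rtrancl insertI1)
  qed
qed simp

lemma rooted_tree_path:
  assumes "rooted_tree V E r" "u \<in> V" "v \<in> V"
  shows "\<exists>xs. xs \<noteq> [] \<and> hd xs = u \<and> last xs = v \<and> set xs \<subseteq> V \<and> distinct xs \<and>
    successively (\<lambda>x y. (x, y) \<in> E) xs"
  using assms
proof (induction arbitrary: u v)
  case (single r)
  then show ?case by (intro exI[of _ "[r]"]) auto
next
  case (join V1 E1 r V2 E2 s)
  let ?E = "E1 \<union> E2 \<union> {(r, s), (s, r)}"
  let ?P = "\<lambda>V E u v xs. xs \<noteq> [] \<and> hd xs = u \<and> last xs = v \<and> set xs \<subseteq> V \<and> distinct xs \<and>
    successively (\<lambda>x y. (x, y) \<in> E) xs"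
  note rs = rooted_tree_basic(2)[OF join.hyps(1)] rooted_tree_basic(2)[OF join.hyps(2)]
  have mono: "successively (\<lambda>x y. (x, y) \<in> ?E) xs"
    if "successively (\<lambda>x y. (x, y) \<in> E1) xs \<or> successively (\<lambda>x y. (x, y) \<in> E2) xs" for xs
    using that by (auto intro: successively_mono)
  consider "u \<in> V1" "v \<in> V1" | "u \<in> V2" "v \<in> V2" | "u \<in> V1" "v \<in> V2" | "u \<in> V2" "v \<in> V1"
    using join.prems by auto
  then show ?case
  proof cases
    case 1
    then obtain xs where "?P V1 E1 u v xs" using join.IH(1) by blast
    then show ?thesis using mono by (intro exI[of _ xs]) auto
  next
    case 2
    then obtain xs where "?P V2 E2 u v xs" using join.IH(2) by blast
    then show ?thesis using mono by (intro exI[of _ xs]) auto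
  next
    case 3
    obtain xs where "?P V1 E1 u r xs" using join.IH(1)[OF 3(1) rs(1)] by blast
    moreover obtain ys where "?P V2 E2 s v ys" using join.IH(2)[OF rs(2) 3(2)] by blast
    ultimately show ?thesis using mono \<open>V1 \<inter> V2 = {}\<close>
      by (intro exI[of _ "xs @ ys"]) (auto simp: successively_append_iff)
  next
    case 4
    obtain xs where "?P V2 E2 u s xs" using join.IH(2)[OF 4(1) rs(2)] by blast
    moreover obtain ys where "?P V1 E1 r v ys" using join.IH(1)[OF rs(1) 4(2)] by blast
    ultimately show ?thesis using mono \<open>V1 \<inter> V2 = {}\<close>
      by (intro exI[of _ "xs @ ys"]) (auto simp: successively_append_iff)
  qed
qed

text \<open>\<open>C\<close> stands for the vertices of a cycle, each with two distinct neighbours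
  in \<open>C\<close>. Exempting the root makes the induction work: the only edge between the two
  parts joins their roots, so in each part at most the root can lie in \<open>C\<close>, and then
  \<open>r\<close> would be the only possible neighbour of \<open>s\<close>.\<close>

lemma rooted_tree_no_cyclic_subset:
  assumes "rooted_tree V E r" "C \<subseteq> V"
    and "\<And>v. v \<in> C \<Longrightarrow> v \<noteq> r \<Longrightarrow> \<exists>a\<in>C. \<exists>b\<in>C. a \<noteq> b \<and> (a, v) \<in> E \<and> (v, b) \<in> E"
  shows "C \<subseteq> {r}"
  using assms
proof (induction arbitrary: C)
  case (join V1 E1 r V2 E2 s)
  note b1 = rooted_tree_basic[OF join.hyps(1)] and b2 = rooted_tree_basic[OF join.hyps(2)]
  have C1: "C \<inter> V1 \<subseteq> {r}"
  proof (rule join.IH(1))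
    fix v assume v: "v \<in> C \<inter> V1" "v \<noteq> r"
    then obtain a b where "a \<in> C" "b \<in> C" "a \<noteq> b"
      "(a, v) \<in> E1 \<union> E2 \<union> {(r, s), (s, r)}" "(v, b) \<in> E1 \<union> E2 \<union> {(r, s), (s, r)}"
      using join.prems(2)[of v] by blast
    then show "\<exists>a\<in>C \<inter> V1. \<exists>b\<in>C \<inter> V1. a \<noteq> b \<and> (a, v) \<in> E1 \<and> (v, b) \<in> E1"
      using v b1 b2 \<open>V1 \<inter> V2 = {}\<close> by blast
  qed auto
  have C2: "C \<inter> V2 \<subseteq> {s}"
  proof (rule join.IH(2))
    fix v assume v: "v \<in> C \<inter> V2" "v \<noteq> s"
    then obtain a b where "a \<in> C" "b \<in> C" "a \<noteq> b"
      "(a, v) \<in> E1 \<union> E2 \<union> {(r, s), (s, r)}" "(v, b) \<in> E1 \<union> E2 \<union> {(r, s), (s, r)}"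
      using join.prems(2)[of v] b1 \<open>V1 \<inter> V2 = {}\<close> by blast
    then show "\<exists>a\<in>C \<inter> V2. \<exists>b\<in>C \<inter> V2. a \<noteq> b \<and> (a, v) \<in> E2 \<and> (v, b) \<in> E2"
      using v b1 b2 \<open>V1 \<inter> V2 = {}\<close> by blast
  qed auto
  have "s \<notin> C"
  proof
    assume "s \<in> C"
    then obtain a b where ab: "a \<in> C" "b \<in> C" "a \<noteq> b"
      "(a, s) \<in> E1 \<union> E2 \<union> {(r, s), (s, r)}" "(s, b) \<in> E1 \<union> E2 \<union> {(r, s), (s, r)}"
      using join.prems(2)[of s] b1 b2 \<open>V1 \<inter> V2 = {}\<close> by blast
    have "a \<noteq> s" "b \<noteq> s" using ab b1 b2 \<open>V1 \<inter> V2 = {}\<close> by blast+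
    then have "a = r" "b = r" using ab(1,2) C1 C2 join.prems(1) by blast+
    then show False using ab by blast
  qed
  then show ?case using C1 C2 join.prems(1) by blast
qed simp

section \<open>Rooted trees and connected acyclic graphs\<close>

lemma pcas_conv:
  "pcas u p v \<longleftrightarrow> (if p = [] then u = v else fst (hd p) = u \<and> snd (last p) = v \<and>
     (\<forall>i. Suc i < length p \<longrightarrow> snd (p ! i) = fst (p ! Suc i)))"
proof (induction p arbitrary: u)
  case (Cons e es)
  then show ?case
  proof (cases es)
    case (Cons f fs)
    then show ?thesis using Cons.IH
      by (auto simp: nth_Cons split: nat.splits)
  qed auto
qed simp

lemma pawalk_verts_conv: "pcas u p v \<Longrightarrow> pawalk_verts u p = u # map snd p"
  by (induction p arbitrary: u) auto

lemma rooted_tree_undirected_tree: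
  assumes T: "rooted_tree V E r"
  shows "undirected_tree \<lparr>pverts = V, parcs = E\<rparr>"
proof -
  let ?T = "\<lparr>pverts = V, parcs = E\<rparr>"
  note b = rooted_tree_basic[OF T]
  have fE: "finite E" using b finite_subset by blast
  interpret pair_graph ?T
    using b fE by unfold_locales (auto simp: symmetric_def)
  have conn: "connected (with_proj ?T)"
    unfolding connected_def
  proof (rule strongly_connectedI)
    \<comment> \<open>\<open>connected\<close> speaks of the symmetric closure, which changes
      nothing for a symmetric arc set.\<close>
    have sy: "with_proj (mk_symmetric (with_proj ?T)) = with_proj ?T"
      using b(4) by (auto simp: mk_symmetric_def sym_def with_proj_def)
    fix u v
    assume "u \<in> verts (with_proj (mk_symmetric (with_proj ?T)))"
      "v \<in> verts (with_proj (mk_symmetric (with_proj ?T)))"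
    then have uv: "u \<in> V" "v \<in> V" by (auto simp: sy)
    have "(u, v) \<in> E\<^sup>*"
      using rooted_tree_reachable[OF T uv(1)] rooted_tree_reachable[OF T uv(2)] sym_rtrancl[OF b(4)]
      by (meson rtrancl_trans symD)
    then have "u \<rightarrow>\<^sup>*\<^bsub>with_proj ?T\<^esub> v"
      using uv b(3) by (simp add: reachable_conv)
    then show "u \<rightarrow>\<^sup>*\<^bsub>with_proj (mk_symmetric (with_proj ?T))\<^esub> v" by (simp add: sy)
  qed (use b in \<open>auto simp: mk_symmetric_def\<close>)
  have "\<not> (cycle p \<and> length p \<ge> 3)" for p
  proof
    assume "cycle p \<and> length p \<ge> 3"
    then obtain u where u: "set p \<subseteq> E" "pcas u p u" "distinct (tl (pawalk_verts u p))" and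
      len: "length p \<ge> 3" unfolding cycle_def awalk_def by auto
    have dist: "distinct (map snd p)" using u(3) by (simp add: pawalk_verts_conv[OF u(2)])
    have ne: "p \<noteq> []" using len by auto
    define n where "n = length p"
    have n: "n \<ge> 3" using len n_def by simp
    have cyc: "snd (p ! i) = fst (p ! (Suc i mod n))" if "i < n" for i
    proof (cases "Suc i = n")
      case True
      then have "p ! i = last p" "p ! (Suc i mod n) = hd p"
        using ne by (auto simp: last_conv_nth hd_conv_nth n_def[symmetric])
      then show ?thesis using u(2) ne by (simp add: pcas_conv)
    next
      case False
      then show ?thesis using u(2) ne that by (simp add: pcas_conv n_def)
    qed
    have inj: "i = j" if "snd (p ! i) = snd (p ! j)" "i < n" "j < n" for i j
      using dist that nth_eq_iff_index_eq[of "map snd p" i j] by (simp add: n_def)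
    \<comment> \<open>The arcs entering and leaving \<open>v\<close> on the cycle provide its two
      neighbours.\<close>
    have two: "\<exists>a\<in>snd ` set p. \<exists>b\<in>snd ` set p. a \<noteq> b \<and> (a, v) \<in> E \<and> (v, b) \<in> E"
      if "v \<in> snd ` set p" for v
    proof -
      from that obtain i where i: "i < n" "v = snd (p ! i)"
        by (auto simp: in_set_conv_nth n_def)
      \<comment> \<open>Adding \<open>n\<close> before subtracting 1 gives the cyclic predecessor
        also for \<open>i = 0\<close>. The indices \<open>j\<close> and \<open>k\<close> differ
        because the cycle has at least three arcs.\<close>
      define j where "j = (i + n - 1) mod n"
      define k where "k = Suc i mod n"
      have j: "j < n" "Suc j mod n = i"
        using i n by (auto simp: j_def mod_Suc_eq)
      have k: "k < n" using n by (simp add: k_def)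
      have jk: "j \<noteq> k"
        using i n by (cases "i = 0"; cases "Suc i = n") (auto simp: j_def k_def mod_if)
      have "p ! i = (snd (p ! j), v)"
        using cyc[OF j(1)] i j(2) by (simp add: prod_eq_iff)
      moreover have "p ! k = (v, snd (p ! k))"
        using cyc[OF i(1)] i by (simp add: k_def prod_eq_iff)
      moreover have "p ! i \<in> E" "p ! k \<in> E"
        using u(1) i k by (auto simp: n_def)
      moreover have "snd (p ! j) \<noteq> snd (p ! k)" using inj j k jk by blast
      ultimately show ?thesis using j k
        by (intro bexI[of _ "snd (p ! j)"] bexI[of _ "snd (p ! k)"]) (auto simp: n_def)
    qed
    have "snd ` set p \<subseteq> {r}"
      by (rule rooted_tree_no_cyclic_subset[OF T]) (use u(1) b(3) two in auto)
    \<comment> \<open>All heads on the cycle would equal \<open>r\<close>, so the neighbours from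
      \<open>two\<close> would produce a loop.\<close>
    then have "\<exists>v. (v, v) \<in> E" using two ne by (metis (no_types, lifting) image_is_empty insert_iff set_empty subset_singletonD singletonD all_not_in_conv)
    then show False using b by blast
  qed
  then show ?thesis
    unfolding undirected_tree_def using conn by (auto intro: pair_graph)
qed

lemma pcas_zip_tl:
  "pcas x (zip (x # xs) xs) (last (x # xs))"
  by (induction xs arbitrary: x) auto

lemma successively_zip: "successively (\<lambda>x y. (x, y) \<in> E) xs \<Longrightarrow> set (zip xs (tl xs)) \<subseteq> E"
  by (induction xs rule: induct_list012) auto

text \<open>A subtree containing \<open>r\<close> is grown by one vertex at a time; acyclicity
  guarantees that the new vertex is attached by a single edge.\<close>

lemma undirected_tree_rooted_tree:
  assumes T: "undirected_tree T" and r: "r \<in> pverts T"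
  shows "rooted_tree (pverts T) (parcs T) r"
proof -
  interpret pair_graph T using T by (simp add: undirected_tree_def)
  have sy: "with_proj (mk_symmetric (with_proj T)) = with_proj T"
    using arcs_symmetric by (auto simp: mk_symmetric_def with_proj_def)
  have conn: "(r, v) \<in> (parcs T)\<^sup>*" if "v \<in> pverts T" for v
  proof -
    have "r \<rightarrow>\<^sup>*\<^bsub>with_proj T\<^esub> v"
      using T r that by (auto simp: undirected_tree_def connected_def strongly_connected_def sy)
    then show ?thesis using reachable_rtranclI by fastforce
  qed
  have grow: "\<exists>S. card S = Suc k \<and> S \<subseteq> pverts T \<and> rooted_tree S (parcs T \<inter> S \<times> S) r"
    if "Suc k \<le> card (pverts T)" for k
    using that
  proof (induction k)
    case 0
    have "parcs T \<inter> {r} \<times> {r} = {}" using pair_no_loops by fastforce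
    then show ?case using r single[of r] by (intro exI[of _ "{r}"]) auto
  next
    case (Suc k)
    then obtain S where S: "card S = Suc k" "S \<subseteq> pverts T" "rooted_tree S (parcs T \<inter> S \<times> S) r"
      by auto
    have rS: "r \<in> S" using rooted_tree_basic(2)[OF S(3)] .
    obtain v where v: "v \<in> pverts T" "v \<notin> S"
      using S(1,2) Suc.prems by (metis Suc_n_not_le_n subset_antisym subsetI)
    \<comment> \<open>A walk from \<open>r\<close> to \<open>v\<close> has to leave \<open>S\<close>
      along some edge.\<close>
    obtain u w where uw: "u \<in> S" "w \<notin> S" "(u, w) \<in> parcs T"
      using conn[OF v(1)] v(2) rS by (induction rule: rtrancl_induct) blast+
    have wT: "w \<in> pverts T" using uw in_arcsD2 by blast
    \<comment> \<open>Two neighbours of \<open>w\<close> in \<open>S\<close>, joined by a path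
      inside \<open>S\<close>, would close a cycle through \<open>w\<close>.\<close>
    have uniq: "u' = u" if u': "u' \<in> S" "(u', w) \<in> parcs T" for u'
    proof (rule ccontr)
      assume "u' \<noteq> u"
      obtain xs where xs: "xs \<noteq> []" "hd xs = u" "last xs = u'" "set xs \<subseteq> S" "distinct xs"
        "successively (\<lambda>x y. (x, y) \<in> parcs T \<inter> S \<times> S) xs"
        using rooted_tree_path[OF S(3) uw(1) u'(1)] by blast
      have "length xs \<noteq> 1" using xs \<open>u' \<noteq> u\<close> by (cases xs) auto
      then have len: "length xs \<ge> 2" using xs(1) by (cases xs; cases "tl xs") auto
      \<comment> \<open>The closed walk starts at \<open>w\<close>, runs through \<open>xs\<close>
        and returns to \<open>w\<close>. Its arcs pair \<open>w # ys\<close> with \<open>ys\<close>,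
        so their heads form \<open>ys\<close>, where \<open>w\<close> occurs only once.\<close>
      define ys where "ys = xs @ [w]"
      have ys: "successively (\<lambda>x y. (x, y) \<in> parcs T) (w # ys)"
      proof -
        have "successively (\<lambda>x y. (x, y) \<in> parcs T) xs"
          using xs(6) by (rule successively_mono) auto
        then show ?thesis
          using xs(1-3) uw(3) u'(2) arcs_symmetric
          by (simp add: ys_def successively_append_iff successively_Cons)
      qed
      have cas: "pcas w (zip (w # ys) ys) w"
        using pcas_zip_tl[of w ys] by (simp add: ys_def)
      have "map snd (zip (w # ys) ys) = ys" by (rule map_snd_zip_take[THEN trans]) simp
      then have "distinct (map snd (zip (w # ys) ys))"
        using xs uw by (auto simp: ys_def)
      then have "cycle (zip (w # ys) ys)"
        unfolding cycle_def awalk_def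
        using cas pawalk_verts_conv[OF cas] successively_zip[OF ys] wT
        by (intro exI[of _ w]) (auto simp: ys_def)
      moreover have "length (zip (w # ys) ys) \<ge> 3" using len by (simp add: ys_def)
      ultimately show False using T by (auto simp: undirected_tree_def)
    qed
    have eq: "parcs T \<inter> insert w S \<times> insert w S = insert (u, w) (insert (w, u) (parcs T \<inter> S \<times> S))"
    proof (intro equalityI subrelI)
      fix x y assume xy: "(x, y) \<in> parcs T \<inter> insert w S \<times> insert w S"
      then consider "x \<in> S" "y \<in> S" | "x = w" "y \<in> S" | "x \<in> S" "y = w"
        using pair_no_loops[of "(w, w)"] by auto
      then show "(x, y) \<in> insert (u, w) (insert (w, u) (parcs T \<inter> S \<times> S))"
        by cases (use xy uniq[of x] uniq[of y] arcs_symmetric[of w y] in auto)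
    qed (use uw arcs_symmetric[OF uw(3)] in auto)
    have "rooted_tree (insert w S) (parcs T \<inter> insert w S \<times> insert w S) r"
      unfolding eq by (rule rooted_tree_add_leaf[OF S(3) uw(1,2)])
    moreover have "card (insert w S) = Suc (Suc k)"
      using S(1) uw(2) rooted_tree_basic(1)[OF S(3)] by simp
    ultimately show ?case using S(2) wT by (intro exI[of _ "insert w S"]) auto
  qed
  have "card (pverts T) \<noteq> 0" using r pair_finite_verts by auto
  then obtain k where k: "card (pverts T) = Suc k" by (cases "card (pverts T)") auto
  then obtain S where S: "card S = Suc k" "S \<subseteq> pverts T" "rooted_tree S (parcs T \<inter> S \<times> S) r"
    using grow[of k] by auto
  have "S = pverts T" using S k pair_finite_verts by (simp add: card_subset_eq)
  moreover have "parcs T \<inter> pverts T \<times> pverts T = parcs T" using in_arcsD1 in_arcsD2 by auto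
  ultimately show ?thesis using S(3) by simp
qed

section \<open>Leaves, degrees and the recognition of paths\<close>

text \<open>The hanging tree either has a leaf other than its root \<open>s\<close>, whose degree
  the new edge leaves unchanged, or it is just \<open>s\<close>, which becomes a leaf.\<close>

lemma rooted_tree_leaf:
  assumes "rooted_tree V E r" "2 \<le> card V"
  shows "\<exists>v\<in>V. v \<noteq> r \<and> card (E `` {v}) = 1"
  using assms
proof (induction)
  case (join V1 E1 r V2 E2 s)
  let ?E = "E1 \<union> E2 \<union> {(r, s), (s, r)}"
  note b1 = rooted_tree_basic[OF join.hyps(1)] and b2 = rooted_tree_basic[OF join.hyps(2)]
  show ?case
  proof (cases "2 \<le> card V2")
    case True
    then obtain v where v: "v \<in> V2" "v \<noteq> s" "card (E2 `` {v}) = 1" using join.IH(2) by auto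
    have "?E `` {v} = E2 `` {v}"
      using v b1 b2 \<open>V1 \<inter> V2 = {}\<close> by blast
    then show ?thesis using v b1 b2 \<open>V1 \<inter> V2 = {}\<close> by (intro bexI[of _ v]) auto
  next
    case False
    then have "card V2 = 1" using b2 by (cases "card V2") auto
    then have "V2 = {s}" using b2(2) by (metis card_1_singletonE singletonD)
    then have "?E `` {s} = {r}"
      using b1 b2 \<open>V1 \<inter> V2 = {}\<close> by blast
    then show ?thesis using b1 b2 \<open>V1 \<inter> V2 = {}\<close> by (intro bexI[of _ s]) auto
  qed
qed simp

text \<open>The additional vertex is placed in front as 0 and the others are shifted, which suits an
  enumeration that begins at the root.\<close>

lemma parcs_path_graph_Suc:
  "parcs (path_graph (Suc n)) = insert (0, 1) (insert (1, 0) (map_prod Suc Suc ` parcs (path_graph n)))"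
  if "0 < n"
proof (intro equalityI subsetI)
  fix e assume "e \<in> parcs (path_graph (Suc n))"
  then show "e \<in> insert (0, 1) (insert (1, 0) (map_prod Suc Suc ` parcs (path_graph n)))"
    by (cases e; cases "fst e"; cases "snd e") (auto simp: path_graph_def image_iff)
qed (use that in \<open>auto simp: path_graph_def\<close>)

text \<open>The edge to \<open>s\<close> exhausts the degree of the root, so the upper part is a
  single vertex. One of the at most two edges at \<open>s\<close> leads to \<open>r\<close>, so
  \<open>s\<close> meets the degree bound that the induction hypothesis puts on a root.\<close>

lemma rooted_tree_max_degree_2:
  assumes "rooted_tree V E r" "card (E `` {r}) \<le> 1" "\<And>v. card (E `` {v}) \<le> 2"
  shows "\<exists>g. bij_betw g {..<card V} V \<and> g 0 = r \<and> E = map_prod g g ` parcs (path_graph (card V))"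
  using assms
proof (induction)
  case (single r)
  then show ?case
    by (intro exI[of _ "\<lambda>_. r"]) (auto simp: path_graph_def bij_betw_def lessThan_Suc)
next
  case (join V1 E1 r V2 E2 s)
  let ?E = "E1 \<union> E2 \<union> {(r, s), (s, r)}"
  note b1 = rooted_tree_basic[OF join.hyps(1)] and b2 = rooted_tree_basic[OF join.hyps(2)]
  have fin: "finite (?E `` {v})" for v
  proof (rule finite_subset)
    show "?E `` {v} \<subseteq> V1 \<union> V2" using b1(2,3) b2(2,3) by blast
  qed (use b1(1) b2(1) in simp)
  have "E1 `` {r} = {}"
  proof (rule ccontr)
    assume "E1 `` {r} \<noteq> {}"
    then obtain x where "x \<in> E1 `` {r}" by auto
    then have "{x, s} \<subseteq> ?E `` {r}" "x \<noteq> s"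
      using b1(3) b2(2) \<open>V1 \<inter> V2 = {}\<close> by blast+
    then show False using join.prems(1) card_mono[OF fin, of "{x, s}" r] by simp
  qed
  with join.hyps(1) have V1: "V1 = {r}" "E1 = {}"
    by (auto elim: rooted_tree.cases)
  have r: "r \<notin> V2" using V1 \<open>V1 \<inter> V2 = {}\<close> by auto
  have "?E `` {s} = insert r (E2 `` {s})" "r \<notin> E2 `` {s}" "finite (E2 `` {s})"
    using V1 b2 r finite_subset[of "E2 `` {s}" V2] by auto
  then have "card (E2 `` {s}) \<le> 1" using join.prems(2)[of s] by simp
  moreover have "card (E2 `` {v}) \<le> 2" for v
    using join.prems(2)[of v] card_mono[OF fin, of "E2 `` {v}" v] by fastforce
  ultimately obtain g where g: "bij_betw g {..<card V2} V2" "g 0 = s"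
    "E2 = map_prod g g ` parcs (path_graph (card V2))"
    using join.IH(2) by blast
  have card: "card (V1 \<union> V2) = Suc (card V2)" using V1 r b2 by simp
  have pos: "0 < card V2" using b2 card_gt_0_iff by blast
  \<comment> \<open>The root \<open>r\<close> gets number 0, and the numbers in the hanging path
    move up by one.\<close>
  let ?g = "case_nat r g"
  have "bij_betw ?g (insert 0 (Suc ` {..<card V2})) (insert r V2)"
  proof -
    have "inj_on ?g (insert 0 (Suc ` {..<card V2}))"
      using g(1) r by (auto simp: inj_on_def bij_betw_def)
    moreover have "?g ` insert 0 (Suc ` {..<card V2}) = insert r V2"
      using g(1) by (simp add: bij_betw_def image_image)
    ultimately show ?thesis by (simp add: bij_betw_def)
  qed
  moreover have "insert 0 (Suc ` {..<card V2}) = {..<card (V1 \<union> V2)}"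
    unfolding card by (simp add: lessThan_Suc_eq_insert_0)
  moreover have "?E = map_prod ?g ?g ` parcs (path_graph (card (V1 \<union> V2)))"
    unfolding card parcs_path_graph_Suc[OF pos] using V1 g(2,3)
    by (simp add: image_image map_prod_def case_prod_beta)
  ultimately show ?case using V1 by (intro exI[of _ ?g]) simp
qed

lemma tree_max_degree_2_iso_path:
  assumes T: "undirected_tree T" and deg: "\<And>v. card (parcs T `` {v}) \<le> 2"
  shows "digraph_iso (with_proj T) (with_proj (path_graph (card (pverts T))))"
proof -
  interpret pair_graph T using T by (simp add: undirected_tree_def)
  let ?V = "pverts T" and ?E = "parcs T"
  have "?V \<noteq> {}" using T by (auto simp: undirected_tree_def connected_def strongly_connected_def mk_symmetric_def)
  then obtain r where r: "r \<in> ?V" by auto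
  \<comment> \<open>An end of the future path, to serve as root: a leaf, or the only vertex there
    is.\<close>
  have "\<exists>v\<in>?V. card (?E `` {v}) \<le> 1"
  proof (cases "2 \<le> card ?V")
    case True
    then obtain v where "v \<in> ?V" "card (?E `` {v}) = 1"
      using rooted_tree_leaf[OF undirected_tree_rooted_tree[OF T r]] by blast
    then show ?thesis by (intro bexI[of _ v]) simp_all
  next
    case False
    then have "card ?V = 1" using r pair_finite_verts by (cases "card ?V") auto
    moreover have "card (?E `` {r}) \<le> card ?V"
      using in_arcsD2 by (intro card_mono pair_finite_verts) auto
    ultimately show ?thesis using r by auto
  qed
  then obtain v where v: "v \<in> ?V" "card (?E `` {v}) \<le> 1" by auto
  let ?P = "path_graph (card ?V)"
  obtain g where g: "bij_betw g {..<card ?V} ?V" "?E = map_prod g g ` parcs ?P"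
    using rooted_tree_max_degree_2[OF undirected_tree_rooted_tree[OF T v(1)] v(2) deg] by auto
  \<comment> \<open>\<open>g\<close> numbers the vertices, whereas the isomorphism has to lead from
    \<open>T\<close> to the path, hence the inverse.\<close>
  define h where "h = inv_into {..<card ?V} g"
  have h: "bij_betw h ?V {..<card ?V}" using g(1) by (simp add: h_def bij_betw_inv_into)
  have hg: "h (g i) = i" if "i < card ?V" for i
    using g(1) that by (simp add: h_def bij_betw_inv_into_left)
  let ?f = "\<lparr>iso_verts = h, iso_arcs = map_prod h h, iso_head = snd, iso_tail = fst\<rparr>"
  have "digraph_isomorphism ?f"
    unfolding digraph_isomorphism_def
  proof (intro conjI)
    have "inj_on h ?V" using h by (simp add: bij_betw_def)
    then have "inj_on (map_prod h h) (?V \<times> ?V)" by (simp add: map_prod_inj_on)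
    then show "inj_on (iso_arcs ?f) ?E"
      using in_arcsD1 in_arcsD2 by (simp, elim inj_on_subset) auto
  qed (use h in \<open>auto simp: bij_betw_def intro: wf_digraph\<close>)
  moreover have "with_proj ?P = app_iso ?f (with_proj T)"
  proof -
    have "map_prod h h ` ?E = (\<lambda>e. e) ` parcs ?P"
      unfolding g(2) image_image by (rule image_cong) (auto simp: path_graph_def hg)
    moreover have "h ` ?V = {..<card ?V}" using h by (simp add: bij_betw_def)
    ultimately show ?thesis by (simp add: with_proj_def app_iso_def path_graph_def)
  qed
  ultimately show ?thesis unfolding digraph_iso_def by blast
qed

text \<open>An isomorphism maps the neighbours of \<open>v\<close> injectively to neighbours of its
  image. This will show that a star is not a path.\<close>

lemma iso_path_max_degree_2:
  assumes iso: "digraph_iso (with_proj T) (with_proj (path_graph n))"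
    and v: "v \<in> pverts T"
  shows "card (parcs T `` {v}) \<le> 2"
proof -
  obtain f where f: "pre_digraph.digraph_isomorphism (with_proj T) f"
    "with_proj (path_graph n) = app_iso f (with_proj T)"
    using iso by (auto simp: digraph_iso_def)
  have wf: "wf_digraph (with_proj T)" and inj: "inj_on (iso_verts f) (pverts T)"
    and ends: "\<And>e. e \<in> parcs T \<Longrightarrow> iso_verts f (fst e) = iso_tail f (iso_arcs f e) \<and>
      iso_verts f (snd e) = iso_head f (iso_arcs f e)"
    using f(1) by (auto simp: pre_digraph.digraph_isomorphism_def)
  have tf: "iso_tail f = fst" "iso_head f = snd" and arcs: "parcs (path_graph n) = iso_arcs f ` parcs T"
    using f(2) by (auto simp: with_proj_def app_iso_def)
  let ?h = "iso_verts f"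
  have "?h ` (parcs T `` {v}) \<subseteq> parcs (path_graph n) `` {?h v}"
  proof
    fix x assume "x \<in> ?h ` (parcs T `` {v})"
    then obtain w where w: "(v, w) \<in> parcs T" "x = ?h w" by auto
    then have "iso_arcs f (v, w) = (?h v, x)" using ends[of "(v, w)"] tf by (simp add: prod_eq_iff)
    then show "x \<in> parcs (path_graph n) `` {?h v}" using w(1) arcs by force
  qed
  \<comment> \<open>If \<open>?h v\<close> is 0, truncated subtraction gives 0 again, which only
    enlarges the set on the right.\<close>
  also have "\<dots> \<subseteq> {?h v - 1, Suc (?h v)}" by (auto simp: path_graph_def)
  finally have sub: "?h ` (parcs T `` {v}) \<subseteq> {?h v - 1, Suc (?h v)}" .
  have "parcs T `` {v} \<subseteq> pverts T" using wf_digraph.head_in_verts[OF wf] by force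
  then have "card (parcs T `` {v}) = card (?h ` (parcs T `` {v}))"
    using inj by (metis card_image inj_on_subset)
  also have "\<dots> \<le> card {?h v - 1, Suc (?h v)}" by (rule card_mono[OF _ sub]) simp
  also have "\<dots> \<le> 2" by (simp add: card_insert_if)
  finally show ?thesis .
qed

section \<open>Paths and stars as rooted trees\<close>

lemma parcs_path_graph_Suc_Suc:
  "parcs (path_graph (Suc (Suc n))) = parcs (path_graph (Suc n)) \<union> {(Suc n, n), (n, Suc n)}"
  by (auto simp: path_graph_def)

text \<open>With the last vertex as root, lengthening the path puts a new root above the old one,
  which matches one more application of \<open>adj\<close> in \<open>walks\<close>.\<close>

lemma path_graph_rooted_tree:
  "rooted_tree {..<Suc n} (parcs (path_graph (Suc n))) n"
proof (induction n)
  case 0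
  have "parcs (path_graph (Suc 0)) = {}" by (auto simp: path_graph_def)
  then show ?case using single[of "0::nat"] by (simp add: lessThan_Suc)
next
  case (Suc n)
  have "rooted_tree ({Suc n} \<union> {..<Suc n}) ({} \<union> parcs (path_graph (Suc n)) \<union> {(Suc n, n), (n, Suc n)}) (Suc n)"
    by (rule join[OF single Suc]) auto
  then show ?case by (simp add: parcs_path_graph_Suc_Suc lessThan_Suc[of "Suc n"] insert_commute)
qed

definition star_arcs :: "nat \<Rightarrow> (nat \<times> nat) set" where
  "star_arcs k = {0} \<times> {1..k} \<union> {1..k} \<times> {0}"

lemma star_arcs_Suc: "star_arcs (Suc k) = star_arcs k \<union> {} \<union> {(0, Suc k), (Suc k, 0)}"
  by (auto simp: star_arcs_def)

lemma star_rooted_tree: "rooted_tree {..k} (star_arcs k) 0"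
proof (induction k)
  case 0
  show ?case using single[of "0::nat"] by (simp add: star_arcs_def)
next
  case (Suc k)
  have "rooted_tree ({..k} \<union> {Suc k}) (star_arcs (Suc k)) 0"
    unfolding star_arcs_Suc by (rule join[OF Suc single]) auto
  then show ?case by (simp add: atMost_Suc)
qed

section \<open>Colourings of trees\<close>

context nested_graph
begin

section \<open>Colourings with a prescribed colour at the root\<close>

definition rooted_count :: "'c set \<Rightarrow> ('c \<times> 'c) set \<Rightarrow> 'c \<Rightarrow> 'b \<Rightarrow> real" where
  "rooted_count T E r i = real (card {f \<in> T \<rightarrow>\<^sub>E V. (\<forall>(u, v)\<in>E. (f u, f v) \<in> A) \<and> f r = i})"

lemma rooted_count_single:
  assumes "i \<in> V"
  shows "rooted_count {r} {} r i = 1"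
proof -
  have "{f \<in> {r} \<rightarrow>\<^sub>E V. (\<forall>(u, v)\<in>{}. (f u, f v) \<in> A) \<and> f r = i} = {\<lambda>x\<in>{r}. i}"
    using assms by (auto simp: PiE_iff extensional_def fun_eq_iff)
  then show ?thesis by (simp add: rooted_count_def)
qed

text \<open>A colouring of the joined tree is a pair of colourings of the parts, linked only by the
  edge between \<open>r\<close> and \<open>s\<close>: the colour of \<open>s\<close> must be a
  neighbour of \<open>i\<close>, and \<open>adj\<close> sums over these colours.\<close>

lemma rooted_count_join:
  assumes T1: "rooted_tree T1 E1 r" and T2: "rooted_tree T2 E2 s" and disj: "T1 \<inter> T2 = {}"
  shows "rooted_count (T1 \<union> T2) (E1 \<union> E2 \<union> {(r, s), (s, r)}) r i =
    rooted_count T1 E1 r i * adj (rooted_count T2 E2 s) i"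
proof -
  note b1 = rooted_tree_basic[OF T1] and b2 = rooted_tree_basic[OF T2]
  let ?E = "E1 \<union> E2 \<union> {(r, s), (s, r)}"
  define S where "S = {f \<in> T1 \<union> T2 \<rightarrow>\<^sub>E V. (\<forall>(u, v)\<in>?E. (f u, f v) \<in> A) \<and> f r = i}"
  define S1 where "S1 = {f \<in> T1 \<rightarrow>\<^sub>E V. (\<forall>(u, v)\<in>E1. (f u, f v) \<in> A) \<and> f r = i}"
  define S2 where "S2 j = {f \<in> T2 \<rightarrow>\<^sub>E V. (\<forall>(u, v)\<in>E2. (f u, f v) \<in> A) \<and> f s = j}" for j
  have fin: "finite (S2 j)" for j
    unfolding S2_def using b2(1) finite_V by (auto intro!: finite_PiE)
  let ?glue = "\<lambda>(f, g) x. if x \<in> T1 then f x else g x"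
  have "bij_betw (\<lambda>f. (restrict f T1, restrict f T2)) S (S1 \<times> (\<Union>j\<in>A `` {i}. S2 j))"
  proof (rule bij_betw_byWitness[where f' = ?glue])
    show "\<forall>f\<in>S. ?glue (restrict f T1, restrict f T2) = f"
      by (auto simp: S_def PiE_iff extensional_def fun_eq_iff)
    show "\<forall>p\<in>S1 \<times> (\<Union>j\<in>A `` {i}. S2 j). (\<lambda>f. (restrict f T1, restrict f T2)) (?glue p) = p"
      using disj by (auto simp: S1_def S2_def PiE_iff extensional_def fun_eq_iff)
    show "(\<lambda>f. (restrict f T1, restrict f T2)) ` S \<subseteq> S1 \<times> (\<Union>j\<in>A `` {i}. S2 j)"
    proof
      fix p assume "p \<in> (\<lambda>f. (restrict f T1, restrict f T2)) ` S"
      then obtain f where f: "f \<in> S" "p = (restrict f T1, restrict f T2)" by auto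
      have E: "(f u, f v) \<in> A" if "(u, v) \<in> ?E" for u v
        using f(1) that unfolding S_def by blast
      have fV: "f x \<in> V" if "x \<in> T1 \<union> T2" for x
        using f(1) that unfolding S_def by blast
      have fr: "f r = i" using f(1) unfolding S_def by blast
      have "(restrict f T1 u, restrict f T1 v) \<in> A" if "(u, v) \<in> E1" for u v
      proof -
        have "u \<in> T1" "v \<in> T1" using that b1(3) by blast+
        then show ?thesis using E[of u v] that by simp
      qed
      then have "restrict f T1 \<in> S1"
        unfolding S1_def using fV fr b1(2) by fastforce
      moreover have "(restrict f T2 u, restrict f T2 v) \<in> A" if "(u, v) \<in> E2" for u v
      proof -
        have "u \<in> T2" "v \<in> T2" using that b2(3) by blast+
        then show ?thesis using E[of u v] that by simp
      qed
      then have "restrict f T2 \<in> S2 (f s)"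
        unfolding S2_def using fV b2(2) by fastforce
      moreover have "f s \<in> A `` {i}"
        using E[of r s] fr by simp
      ultimately show "p \<in> S1 \<times> (\<Union>j\<in>A `` {i}. S2 j)" using f(2) by blast
    qed
    show "?glue ` (S1 \<times> (\<Union>j\<in>A `` {i}. S2 j)) \<subseteq> S"
    proof
      fix h assume "h \<in> ?glue ` (S1 \<times> (\<Union>j\<in>A `` {i}. S2 j))"
      then obtain f g where fg: "f \<in> S1" "g \<in> S2 (g s)" "(i, g s) \<in> A"
        and h: "h = (\<lambda>x. if x \<in> T1 then f x else g x)"
        by (auto simp: S2_def)
      have h1: "h x = f x" if "x \<in> T1" for x using that h by simp
      have h2: "h x = g x" if "x \<in> T2" for x using that h disj by auto
      have "h \<in> T1 \<union> T2 \<rightarrow>\<^sub>E V"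
        using fg by (auto simp: h S1_def S2_def PiE_iff extensional_def)
      moreover have "(h u, h v) \<in> A" if uv: "(u, v) \<in> ?E" for u v
      proof -
        have rs: "(h r, h s) \<in> A"
          using fg(3) h1[OF b1(2)] h2[OF b2(2)] fg(1) by (simp add: S1_def)
        consider "(u, v) \<in> E1" | "(u, v) \<in> E2" | "u = r" "v = s" | "u = s" "v = r"
          using uv by blast
        then show ?thesis
        proof cases
          case 1
          then have "u \<in> T1" "v \<in> T1" using b1(3) by blast+
          moreover have "(f u, f v) \<in> A" using 1 fg(1) unfolding S1_def by blast
          ultimately show ?thesis by (simp add: h1)
        next
          case 2
          then have "u \<in> T2" "v \<in> T2" using b2(3) by blast+
          moreover have "(g u, g v) \<in> A" using 2 fg(2) unfolding S2_def by blast
          ultimately show ?thesis by (simp add: h2)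
        next
          case 3
          then show ?thesis using rs by simp
        next
          case 4
          then show ?thesis using rs sym_A by (simp add: symD)
        qed
      qed
      moreover have "h r = i" using h1 b1(2) fg(1) by (simp add: S1_def)
      ultimately show "h \<in> S" unfolding S_def by blast
    qed
  qed
  then have "card S = card (S1 \<times> (\<Union>j\<in>A `` {i}. S2 j))" by (rule bij_betw_same_card)
  also have "\<dots> = card S1 * (\<Sum>j\<in>A `` {i}. card (S2 j))"
  proof -
    \<comment> \<open>The union is disjoint because \<open>S2 j\<close> prescribes the colour of
      \<open>s\<close>.\<close>
    have "card (\<Union>j\<in>A `` {i}. S2 j) = (\<Sum>j\<in>A `` {i}. card (S2 j))"
      using finite_nbhd fin by (intro card_UN_disjoint) (auto simp: S2_def)
    then show ?thesis by (simp add: card_cartesian_product)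
  qed
  finally have "real (card S) = real (card S1) * (\<Sum>j\<in>A `` {i}. real (card (S2 j)))" by simp
  then show ?thesis
    by (simp add: rooted_count_def adj_def S_def S1_def S2_def)
qed

text \<open>The counts arise from the constant 1 by products and \<open>adj\<close>, both of which
  preserve monotonicity.\<close>

lemma nbhd_mono_rooted_count: "rooted_tree T E r \<Longrightarrow> nbhd_mono (rooted_count T E r)"
proof (induction rule: rooted_tree.induct)
  case (single r)
  then show ?case by (simp add: nbhd_mono_def rooted_count_single)
next
  case (join T1 E1 r T2 E2 s)
  have "nbhd_mono (\<lambda>i. rooted_count T1 E1 r i * adj (rooted_count T2 E2 s) i)"
    by (intro nbhd_mono_mult nbhd_mono_adj join.IH)
  then show ?case by (simp only: nbhd_mono_def rooted_count_join[OF join.hyps])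
qed

text \<open>Every branch at the root is straightened into a path with as many edges.\<close>
lemma spider_le_rooted_count:
  assumes "rooted_tree T E r"
  shows "\<exists>ms. length ms = card (E `` {r}) \<and> 0 \<notin> set ms \<and> Suc (sum_list ms) = card T \<and>
    (\<forall>x. nbhd_mono x \<longrightarrow> (\<Sum>i\<in>V. x i * spider ms i) \<le> (\<Sum>i\<in>V. x i * rooted_count T E r i))"
  using assms
proof (induction)
  case (single r)
  then show ?case
    by (intro exI[of _ "[]"]) (simp add: spider_Nil rooted_count_single)
next
  case (join T1 E1 r T2 E2 s)
  note b1 = rooted_tree_basic[OF join.hyps(1)] and b2 = rooted_tree_basic[OF join.hyps(2)]
  let ?E = "E1 \<union> E2 \<union> {(r, s), (s, r)}"
  let ?c1 = "rooted_count T1 E1 r" and ?c2 = "rooted_count T2 E2 s"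
  obtain ms where ms: "length ms = card (E1 `` {r})" "0 \<notin> set ms" "Suc (sum_list ms) = card T1"
    and ms_le: "\<And>x. nbhd_mono x \<Longrightarrow> (\<Sum>i\<in>V. x i * spider ms i) \<le> (\<Sum>i\<in>V. x i * ?c1 i)"
    using join.IH(1) by blast
  obtain ns where ns: "Suc (sum_list ns) = card T2"
    and ns_le: "\<And>x. nbhd_mono x \<Longrightarrow> (\<Sum>i\<in>V. x i * spider ns i) \<le> (\<Sum>i\<in>V. x i * ?c2 i)"
    using join.IH(2) by blast
  \<comment> \<open>The branch through \<open>s\<close> becomes one leg: the edges of the
    straightened hanging tree and the edge from \<open>r\<close> to \<open>s\<close>.\<close>
  let ?m = "Suc (sum_list ns)"
  have le: "(\<Sum>i\<in>V. x i * spider (?m # ms) i) \<le> (\<Sum>i\<in>V. x i * rooted_count (T1 \<union> T2) ?E r i)"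
    if x: "nbhd_mono x" for x
  proof -
    have xc: "nbhd_mono (\<lambda>i. x i * ?c1 i)"
      by (intro nbhd_mono_mult x nbhd_mono_rooted_count join.hyps)
    have "(\<Sum>i\<in>V. x i * spider (?m # ms) i) = (\<Sum>i\<in>V. x i * walks ?m i * spider ms i)"
      by (simp add: spider_Cons mult_ac)
    also have "\<dots> \<le> (\<Sum>i\<in>V. x i * walks ?m i * ?c1 i)"
      by (intro ms_le nbhd_mono_mult x nbhd_mono_walks)
    also have "\<dots> = (\<Sum>i\<in>V. x i * ?c1 i * adj (walks (sum_list ns)) i)"
      by (simp add: walks_Suc mult_ac)
    \<comment> \<open>Moving \<open>adj\<close> to the other factor re-roots the sum at
      \<open>s\<close>. Everything on the side of \<open>r\<close> becomes a monotone weight there,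
      so the merging inequality and the induction hypothesis for the hanging tree apply.\<close>
    also have "\<dots> = (\<Sum>i\<in>V. adj (\<lambda>i. x i * ?c1 i) i * walks (sum_list ns) i)"
      by (rule adj_self_adjoint)
    also have "\<dots> \<le> (\<Sum>i\<in>V. adj (\<lambda>i. x i * ?c1 i) i * spider ns i)"
      by (intro walks_le_spider nbhd_mono_adj xc)
    also have "\<dots> \<le> (\<Sum>i\<in>V. adj (\<lambda>i. x i * ?c1 i) i * ?c2 i)"
      by (intro ns_le nbhd_mono_adj xc)
    also have "\<dots> = (\<Sum>i\<in>V. x i * ?c1 i * adj ?c2 i)"
      by (rule adj_self_adjoint[symmetric])
    also have "\<dots> = (\<Sum>i\<in>V. x i * rooted_count (T1 \<union> T2) ?E r i)"
      by (simp only: rooted_count_join[OF join.hyps] mult.assoc)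
    finally show ?thesis .
  qed
  have "?E `` {r} = insert s (E1 `` {r})" "s \<notin> E1 `` {r}" "finite (E1 `` {r})"
    using b1 b2 \<open>T1 \<inter> T2 = {}\<close> finite_subset[of "E1 `` {r}" T1] by auto
  then have "length (?m # ms) = card (?E `` {r})" using ms by simp
  moreover have "Suc (sum_list (?m # ms)) = card (T1 \<union> T2)"
    using ms ns b1 b2 \<open>T1 \<inter> T2 = {}\<close> by (simp add: card_Un_disjoint)
  ultimately show ?case using le ms(2) by (intro exI[of _ "?m # ms"]) auto
qed

text \<open>Each new root contributes one application of \<open>adj\<close>, starting from a single
  vertex; hence \<open>Suc n\<close> vertices correspond to walks with \<open>n\<close>
  edges.\<close>

lemma rooted_count_path:
  "i \<in> V \<Longrightarrow> rooted_count {..<Suc n} (parcs (path_graph (Suc n))) n i = walks n i"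
proof (induction n arbitrary: i)
  case 0
  have "parcs (path_graph (Suc 0)) = {}" by (auto simp: path_graph_def)
  then show ?case
    using rooted_count_single[OF 0, of "0::nat"] by (simp add: walks_0 lessThan_Suc)
next
  case (Suc n)
  have eq: "{..<Suc (Suc n)} = {Suc n} \<union> {..<Suc n}"
    "parcs (path_graph (Suc (Suc n))) = {} \<union> parcs (path_graph (Suc n)) \<union> {(Suc n, n), (n, Suc n)}"
    by (auto simp: parcs_path_graph_Suc_Suc)
  have "rooted_count {..<Suc (Suc n)} (parcs (path_graph (Suc (Suc n)))) (Suc n) i =
    rooted_count {Suc n} {} (Suc n) i * adj (rooted_count {..<Suc n} (parcs (path_graph (Suc n))) n) i"
    unfolding eq by (rule rooted_count_join[OF single path_graph_rooted_tree]) auto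
  also have "adj (rooted_count {..<Suc n} (parcs (path_graph (Suc n))) n) = adj (walks n)"
    by (rule adj_cong) (rule Suc.IH)
  finally show ?case using Suc.prems by (simp add: walks_Suc rooted_count_single)
qed

lemma rooted_count_star: "i \<in> V \<Longrightarrow> rooted_count {..k} (star_arcs k) 0 i = walks 1 i ^ k"
proof (induction k)
  case 0
  then show ?case using rooted_count_single[of i "0::nat"] by (simp add: star_arcs_def)
next
  case (Suc k)
  have "rooted_count ({..k} \<union> {Suc k}) (star_arcs (Suc k)) 0 i =
    rooted_count {..k} (star_arcs k) 0 i * adj (rooted_count {Suc k} {} (Suc k)) i"
    unfolding star_arcs_Suc by (rule rooted_count_join[OF star_rooted_tree single]) auto
  also have "adj (rooted_count {Suc k} {} (Suc k)) = adj (walks 0)"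
    by (rule adj_cong) (simp add: rooted_count_single walks_0)
  finally show ?case using Suc by (simp add: atMost_Suc walks_Suc mult.commute)
qed

text \<open>If adjacent vertices have equal neighbourhoods, then all vertices met by a walk have
  the degree of its first vertex.\<close>
lemma walks_regular:
  assumes "\<And>i j. (i, j) \<in> A \<Longrightarrow> A `` {i} = A `` {j}"
  shows "walks k i = walks 1 i ^ k"
proof (induction k arbitrary: i)
  case (Suc k)
  have "walks 1 j = walks 1 i" if "j \<in> A `` {i}" for j
    using assms[of i j] that by (simp add: walks_Suc adj_def walks_0)
  then have "walks (Suc k) i = (\<Sum>j\<in>A `` {i}. walks 1 i ^ k)"
    by (simp add: walks_Suc[of k] adj_def Suc)
  also have "\<dots> = walks 1 i ^ Suc k"
    by (simp add: walks_Suc adj_def walks_0)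
  finally show ?case .
qed (simp add: walks_0)

section \<open>The path compared with other trees\<close>

lemma hom_count_conv:
  assumes "pverts H = V" "parcs H = A" "finite (pverts T)" "r \<in> pverts T"
  shows "real (hom_count T H) = (\<Sum>i\<in>V. rooted_count (pverts T) (parcs T) r i)"
proof -
  let ?S = "\<lambda>i. {f \<in> pverts T \<rightarrow>\<^sub>E V. (\<forall>(u, v)\<in>parcs T. (f u, f v) \<in> A) \<and> f r = i}"
  have "colorings T H = (\<Union>i\<in>V. ?S i)"
    using assms by (auto simp: colorings_def)
  also have "card \<dots> = (\<Sum>i\<in>V. card (?S i))"
  proof (rule card_UN_disjoint)
    have "finite (pverts T \<rightarrow>\<^sub>E V)" using assms finite_V by (auto intro: finite_PiE)
    then show "\<forall>i\<in>V. finite (?S i)" by auto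
  qed (use finite_V in auto)
  finally show ?thesis by (simp add: hom_count_def rooted_count_def)
qed

lemma hom_count_path:
  assumes "pverts H = V" "parcs H = A"
  shows "real (hom_count (path_graph (Suc n)) H) = (\<Sum>i\<in>V. walks n i)"
proof -
  have "pverts (path_graph (Suc n)) = {..<Suc n}" by (simp add: path_graph_def)
  then show ?thesis
    using hom_count_conv[OF assms, of "path_graph (Suc n)" n] by (simp add: rooted_count_path)
qed

lemma hom_count_path_le:
  assumes H: "pverts H = V" "parcs H = A" and T: "undirected_tree T"
  shows "hom_count (path_graph (card (pverts T))) H \<le> hom_count T H"
proof -
  have fin: "finite (pverts T)" and "pverts T \<noteq> {}"
    using T by (auto simp: undirected_tree_def connected_def strongly_connected_def mk_symmetric_def
      pair_graph_def pair_digraph_def pair_fin_digraph_def pair_fin_digraph_axioms_def)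
  then obtain r where r: "r \<in> pverts T" by auto
  obtain ms where ms: "Suc (sum_list ms) = card (pverts T)"
    and le: "\<And>x. nbhd_mono x \<Longrightarrow> (\<Sum>i\<in>V. x i * spider ms i) \<le> (\<Sum>i\<in>V. x i * rooted_count (pverts T) (parcs T) r i)"
    using spider_le_rooted_count[OF undirected_tree_rooted_tree[OF T r]] by blast
  have "real (hom_count (path_graph (card (pverts T))) H) = (\<Sum>i\<in>V. 1 * walks (sum_list ms) i)"
    by (simp add: ms[symmetric] hom_count_path[OF H])
  also have "\<dots> \<le> (\<Sum>i\<in>V. 1 * spider ms i)"
    by (rule walks_le_spider[OF nbhd_mono_1])
  also have "\<dots> \<le> (\<Sum>i\<in>V. 1 * rooted_count (pverts T) (parcs T) r i)"
    by (rule le[OF nbhd_mono_1])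
  also have "\<dots> = real (hom_count T H)"
    by (simp add: hom_count_conv[OF H fin r])
  finally show ?thesis by simp
qed

text \<open>Rooting \<open>T\<close> at a vertex of degree at least 3 yields a spider with at least
  three legs, and passing from the path to this spider is strict.\<close>

lemma hom_count_path_less:
  assumes H: "pverts H = V" "parcs H = A" and T: "undirected_tree T" and deg: "3 \<le> card (parcs T `` {r})"
    and y: "(y, d) \<in> A" and y': "(y', d) \<in> A" and d: "\<And>i j. (i, j) \<in> A \<Longrightarrow> (i, d) \<in> A"
    and ny: "(y, y') \<notin> A"
  shows "hom_count (path_graph (card (pverts T))) H < hom_count T H"
proof -
  interpret T: pair_graph T using T by (simp add: undirected_tree_def)
  have "parcs T `` {r} \<noteq> {}" using deg by auto
  then have r: "r \<in> pverts T" using T.in_arcsD1 by auto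
  obtain ms where ms: "length ms = card (parcs T `` {r})" "0 \<notin> set ms" "Suc (sum_list ms) = card (pverts T)"
    and le: "\<And>x. nbhd_mono x \<Longrightarrow> (\<Sum>i\<in>V. x i * spider ms i) \<le> (\<Sum>i\<in>V. x i * rooted_count (pverts T) (parcs T) r i)"
    using spider_le_rooted_count[OF undirected_tree_rooted_tree[OF T r]] by blast
  have "real (hom_count (path_graph (card (pverts T))) H) = (\<Sum>i\<in>V. walks (sum_list ms) i)"
    by (simp add: ms(3)[symmetric] hom_count_path[OF H])
  also have "\<dots> < (\<Sum>i\<in>V. 1 * spider ms i)"
    using walks_less_spider[OF _ ms(2) y y' d ny] ms(1) deg by simp
  also have "\<dots> \<le> (\<Sum>i\<in>V. 1 * rooted_count (pverts T) (parcs T) r i)"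
    by (rule le[OF nbhd_mono_1])
  also have "\<dots> = real (hom_count T H)"
    by (simp add: hom_count_conv[OF H T.pair_finite_verts r])
  finally show ?thesis by simp
qed

text \<open>Both counts equal the sum of the k-th powers of the degrees in \<open>H\<close>, a loop
  counting once.\<close>

lemma hom_count_star_eq_path:
  assumes H: "pverts H = V" "parcs H = A" and "\<And>i j. (i, j) \<in> A \<Longrightarrow> A `` {i} = A `` {j}"
  shows "hom_count \<lparr>pverts = {..k}, parcs = star_arcs k\<rparr> H = hom_count (path_graph (Suc k)) H"
proof -
  have "real (hom_count \<lparr>pverts = {..k}, parcs = star_arcs k\<rparr> H) = (\<Sum>i\<in>V. walks 1 i ^ k)"
    using hom_count_conv[OF H, of "\<lparr>pverts = {..k}, parcs = star_arcs k\<rparr>" 0]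
    by (simp add: rooted_count_star)
  also have "\<dots> = real (hom_count (path_graph (Suc k)) H)"
    by (simp only: hom_count_path[OF H] walks_regular[OF assms(3), symmetric])
  finally show ?thesis by simp
qed

end

section \<open>Loop threshold graphs\<close>

text \<open>An added isolated vertex has the empty neighbourhood. An added dominating vertex has the
  full vertex set as its neighbourhood and enlarges all older neighbourhoods by the same
  element.\<close>

lemma loop_threshold_nested_graph:
  assumes "loop_threshold H"
  shows "nested_graph (pverts H) (parcs H)"
proof -
  interpret H: pair_pseudo_graph H by (rule loop_threshold_pair_pseudo_graph[OF assms])
  have "parcs H `` {i} \<subseteq> parcs H `` {j} \<or> parcs H `` {j} \<subseteq> parcs H `` {i}"
    if "i \<in> pverts H" "j \<in> pverts H" for i j
    using assms that
  proof (induction arbitrary: i j)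
    case (add_isolated H v)
    interpret G: pair_pseudo_graph H by (rule loop_threshold_pair_pseudo_graph[OF add_isolated.hyps(1)])
    have "parcs H `` {v} = {}" using add_isolated.hyps(2) G.in_arcsD1 by auto
    then show ?case using add_isolated by auto
  next
    case (add_looped_dominating H v)
    interpret G: pair_pseudo_graph H by (rule loop_threshold_pair_pseudo_graph[OF add_looped_dominating.hyps(1)])
    let ?E = "parcs H \<union> {v} \<times> insert v (pverts H) \<union> insert v (pverts H) \<times> {v}"
    have v: "?E `` {v} = insert v (pverts H)" using G.in_arcsD2 by auto
    have u: "?E `` {u} = insert v (parcs H `` {u})" "parcs H `` {u} \<subseteq> pverts H" if "u \<in> pverts H" for u
      using that add_looped_dominating.hyps(2) G.in_arcsD2 by auto
    show ?case
    proof (cases "i = v \<or> j = v")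
      case True
      moreover have "?E `` {k} \<subseteq> ?E `` {v}" if "k \<in> insert v (pverts H)" for k
        using v u[of k] that by (cases "k = v") auto
      ultimately show ?thesis using add_looped_dominating.prems by auto
    next
      case False
      then have ij: "i \<in> pverts H" "j \<in> pverts H" using add_looped_dominating.prems by auto
      then have "?E `` {i} \<subseteq> ?E `` {j} \<or> ?E `` {j} \<subseteq> ?E `` {i}"
        using add_looped_dominating.IH[of i j] unfolding u(1)[OF ij(1)] u(1)[OF ij(2)]
        by blast
      then show ?thesis by (simp only: pair_pre_digraph.simps)
    qed
  qed auto
  then show ?thesis
    using H.pair_finite_verts H.in_arcsD1 H.in_arcsD2 H.arcs_symmetric
    by unfold_locales (auto simp: sym_def)
qed

text \<open>The looped vertex added last is adjacent to every vertex that has a neighbour, since all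
  later vertices are isolated; without looped vertices there are no arcs.\<close>

lemma loop_threshold_dominating:
  assumes "loop_threshold H"
  shows "\<exists>d. \<forall>(i, j)\<in>parcs H. (i, d) \<in> parcs H"
  using assms
proof (induction)
  case (add_looped_dominating H v)
  interpret pair_pseudo_graph H by (rule loop_threshold_pair_pseudo_graph[OF add_looped_dominating.hyps(1)])
  show ?case using in_arcsD1 by (intro exI[of _ v]) auto
qed auto

section \<open>The Hoffman-London properties of loop threshold graphs\<close>

lemma path_graph_in_trees: "0 < n \<Longrightarrow> path_graph n \<in> trees n"
  using rooted_tree_undirected_tree[OF path_graph_rooted_tree[of "n - 1"]]
  by (auto simp: trees_def path_graph_def)

lemma loop_threshold_hoffman_london:
  assumes "loop_threshold H"
  shows "hoffman_london H"
  unfolding hoffman_london_def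
proof (intro allI impI)
  interpret nested_graph "pverts H" "parcs H" by (rule loop_threshold_nested_graph[OF assms])
  fix n :: nat assume n: "1 \<le> n"
  have "Min ((\<lambda>T. hom_count T H) ` trees n) = hom_count (path_graph n) H"
  proof (rule Min_eqI)
    fix h assume "h \<in> (\<lambda>T. hom_count T H) ` trees n"
    then obtain T where "undirected_tree T" "pverts T = {..<n}" "h = hom_count T H"
      by (auto simp: trees_def)
    then show "hom_count (path_graph n) H \<le> h"
      using hom_count_path_le[OF refl refl, of T] by simp
  qed (use finite_trees path_graph_in_trees[of n] n in auto)
  then show "hom_count (path_graph n) H = Min ((\<lambda>T. hom_count T H) ` trees n)" by simp
qed

text \<open>The arcs at \<open>y\<close> and \<open>y'\<close> witness positive degree and are
  exchanged for arcs to a dominating vertex \<open>d\<close>, as the strict merging step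
  requires.\<close>

lemma strongly_hoffman_london_if_nonadjacent:
  assumes H: "loop_threshold H"
    and y: "(y, z) \<in> parcs H" and y': "(y', z') \<in> parcs H" and ny: "(y, y') \<notin> parcs H"
  shows "strongly_hoffman_london H"
  unfolding strongly_hoffman_london_def
proof (intro allI impI ballI)
  interpret nested_graph "pverts H" "parcs H" by (rule loop_threshold_nested_graph[OF H])
  obtain d where d: "\<And>i j. (i, j) \<in> parcs H \<Longrightarrow> (i, d) \<in> parcs H"
    using loop_threshold_dominating[OF H] by blast
  fix n T assume "T \<in> trees n" and niso: "\<not> digraph_iso (with_proj T) (with_proj (path_graph n))"
  then have T: "undirected_tree T" "pverts T = {..<n}" by (auto simp: trees_def)
  \<comment> \<open>With all degrees at most 2 the tree would be a path.\<close>
  have "\<exists>r. \<not> card (parcs T `` {r}) \<le> 2"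
    using tree_max_degree_2_iso_path[OF T(1)] niso T(2) by force
  then obtain r where "\<not> card (parcs T `` {r}) \<le> 2" by blast
  then have "3 \<le> card (parcs T `` {r})" by simp
  then have "hom_count (path_graph (card (pverts T))) H < hom_count T H"
    by (rule hom_count_path_less[OF refl refl T(1) _ d[OF y] d[OF y'] _ ny]) (rule d)
  then show "hom_count (path_graph n) H < hom_count T H" by (simp add: T(2))
qed

text \<open>The counterexample is the star on four vertices: its centre has degree 3, yet it only
  ties with the path.\<close>

lemma not_strongly_hoffman_london_if_regular:
  assumes H: "loop_threshold H"
    and reg: "\<And>i j. (i, j) \<in> parcs H \<Longrightarrow> parcs H `` {i} = parcs H `` {j}"
  shows "\<not> strongly_hoffman_london H"
proof
  interpret nested_graph "pverts H" "parcs H" by (rule loop_threshold_nested_graph[OF H])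
  let ?S = "\<lparr>pverts = {..3}, parcs = star_arcs 3\<rparr>"
  assume strong: "strongly_hoffman_london H"
  have "?S \<in> trees 4"
    using rooted_tree_undirected_tree[OF star_rooted_tree[of 3]] by (auto simp: trees_def)
  moreover have "\<not> digraph_iso (with_proj ?S) (with_proj (path_graph 4))"
  proof
    assume "digraph_iso (with_proj ?S) (with_proj (path_graph 4))"
    then have "card (star_arcs 3 `` {0}) \<le> 2" using iso_path_max_degree_2[of ?S 4 0] by simp
    moreover have "star_arcs 3 `` {0} = {1..3}" by (auto simp: star_arcs_def)
    ultimately show False by simp
  qed
  ultimately have "hom_count (path_graph 4) H < hom_count ?S H"
    using strong by (auto simp: strongly_hoffman_london_def)
  moreover have "hom_count ?S H = hom_count (path_graph (Suc 3)) H"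
    using hom_count_star_eq_path[OF refl refl reg, of 3] by blast
  ultimately show False by simp
qed

theorem theorem4p10:
  fixes H :: "'b pair_pre_digraph"
  assumes "loop_threshold H"
  shows "hoffman_london H \<and>
    (strongly_hoffman_london H \<longleftrightarrow>
       \<not> empty_graph (remove_isolated H) \<and> \<not> fully_looped_complete (remove_isolated H))"
proof -
  interpret pair_pseudo_graph H by (rule loop_threshold_pair_pseudo_graph[OF assms])
  let ?N = "pverts H - isolated_verts H"
  have verts: "verts (remove_isolated H) = ?N"
    by (simp add: remove_isolated_def)
  have arcs: "arcs (remove_isolated H) = {e \<in> parcs H. fst e \<in> ?N \<and> snd e \<in> ?N}"
    by (simp add: remove_isolated_def)
  have dom: "u \<rightarrow>\<^bsub>remove_isolated H\<^esub> v \<longleftrightarrow> (u, v) \<in> parcs H" if "u \<in> ?N" "v \<in> ?N" for u v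
    using that by (auto simp: remove_isolated_def arcs_ends_conv image_iff)
  have N: "i \<in> ?N \<longleftrightarrow> (\<exists>j. j \<noteq> i \<and> (i, j) \<in> parcs H)" for i
    using in_arcsD1 by (auto simp: isolated_verts_def neighborhood_def)
  have NI: "i \<in> ?N" "j \<in> ?N" if "(i, j) \<in> parcs H" "i \<noteq> j" for i j
    using N that arcs_symmetric by metis+
  \<comment> \<open>Each non-isolated vertex keeps an arc, so if no arc is left then no vertex is
    left, and completeness holds vacuously.\<close>
  have complete_if_empty: "fully_looped_complete (remove_isolated H)" if "empty_graph (remove_isolated H)"
  proof -
    have "?N = {}"
    proof (rule ccontr)
      assume "?N \<noteq> {}"
      then obtain i j where "j \<noteq> i" "(i, j) \<in> parcs H" using N by blast
      then have "(i, j) \<in> arcs (remove_isolated H)" using NI[of i j] arcs by simp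
      then show False using that by (simp add: empty_graph_def)
    qed
    then show ?thesis by (simp only: fully_looped_complete_def verts) simp
  qed
  have "strongly_hoffman_london H \<longleftrightarrow> \<not> fully_looped_complete (remove_isolated H)"
  proof
    assume "\<not> fully_looped_complete (remove_isolated H)"
    \<comment> \<open>The vertices may coincide: a missing loop also counts as a non-adjacent
      pair.\<close>
    then obtain y y' where "y \<in> ?N" "y' \<in> ?N" "(y, y') \<notin> parcs H"
      using dom by (auto simp: fully_looped_complete_def verts)
    then show "strongly_hoffman_london H"
      using strongly_hoffman_london_if_nonadjacent[OF assms] N by meson
  next
    assume strong: "strongly_hoffman_london H"
    show "\<not> fully_looped_complete (remove_isolated H)"
    proof
      assume "fully_looped_complete (remove_isolated H)"
      then have complete: "(u, v) \<in> parcs H" if "u \<in> ?N" "v \<in> ?N" for u v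
        using that dom by (cases "u = v") (auto simp: fully_looped_complete_def verts)
      have nbhd: "parcs H `` {i} = ?N" if "i \<in> ?N" for i
        using complete NI that by (metis (no_types, lifting) Image_singleton_iff subsetI subset_antisym)
      \<comment> \<open>An arc between distinct vertices stays within \<open>?N\<close>, where all
        neighbourhoods equal \<open>?N\<close>; for a loop the claim is trivial.\<close>
      have "parcs H `` {i} = parcs H `` {j}" if "(i, j) \<in> parcs H" for i j
        using nbhd NI[OF that] by (cases "i = j") auto
      then show False using not_strongly_hoffman_london_if_regular[OF assms] strong by blast
    qed
  qed
  then show ?thesis
    using loop_threshold_hoffman_london[OF assms] complete_if_empty by blast
qed

end
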